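(* There is a Trimming Oracle for the Bamboo Garden Trimming problem that achieves makespan $2$ (i.e., on every instance, no bamboo ever reaches a height larger than $2$ under the produced perpetual schedule), and that, on instances with $n$ bamboos, uses $O(n)$ space, can be built in $O(n\log n)$ time, and can report the next bamboo to trim in $O(\log n)$ amortized time.
   Context: Bamboo Garden Trimming (BGT) problem: a garden contains $n$ bamboos $b_1,\dots,b_n$; bamboo $b_i$ has daily growth rate $h_i>0$, with $h_1\ge\dots\ge h_n$ and $\sum_{i=1}^n h_i=1$. Initially all heights are $0$. At the end of each day at most one bamboo is trimmed, which instantaneously resets its height to $0$. Days are indexed from $0$: the height of $b_i$ at the end of day $D$, before trimming, is $h_i$ times the number of days elapsed since the last day in which $b_i$ was trimmed, or $(D+1)h_i$ if $b_i$ was never trimmed before day $D$. The makespan of a schedule is the maximum height (measured at the end of a day, before trimming) ever reached by any bamboo over all days. Trimming Oracle: a data structure that is built once from the input growth rates (given in arbitrary order) and is then queried once per day, perpetually, for days $0,1,2,\dots$; the query of day $D$ returns the bamboo to trim at the end of day $D$. The infinite sequence of answers is the perpetual schedule implemented by the oracle, and the oracle achieves makespan $M$ if this schedule has makespan at most $M$. Space is the maximum number of memory words ever used, at any time during the infinite sequence of queries. Amortized query time $O(\log n)$ means that any sequence of the first $m$ queries takes $O(m\log n)$ total time. The computational model is the word RAM with unit-cost arithmetic (including computing $\lfloor\log_2 h_i\rfloor$) on numbers fitting in $O(1)$ memory words; $n$ and the growth rates $h_i$ are assumed to fit in $O(1)$ words (the day index $D$ is unbounded and is not assumed to fit). *)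

theory Defs
  imports Complex_Main "HOL-Library.Extended_Real"
begin

section \<open>Bamboo Garden Trimming\<close>

text \<open>Bamboos are numbered \<open>0, \<dots>, n - 1\<close>. No order of the growth rates is assumed, since
  the input of an oracle is given in arbitrary order.\<close>

definition bgt_instance :: "nat \<Rightarrow> (nat \<Rightarrow> real) \<Rightarrow> bool" where
  "bgt_instance n h \<longleftrightarrow> (\<forall>i<n. 0 < h i) \<and> (\<Sum>i<n. h i) = 1"

text \<open>\<open>s D\<close> is the bamboo trimmed at the end of day \<open>D\<close>, if any.\<close>

type_synonym schedule = "nat \<Rightarrow> nat option"

definition days_since_trim :: "schedule \<Rightarrow> nat \<Rightarrow> nat \<Rightarrow> nat" where
  "days_since_trim s i D =
     (if \<exists>d<D. s d = Some i then D - Max {d. d < D \<and> s d = Some i} else D + 1)"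

text \<open>Height of bamboo \<open>i\<close> at the end of day \<open>D\<close>, before trimming.\<close>

definition height :: "(nat \<Rightarrow> real) \<Rightarrow> schedule \<Rightarrow> nat \<Rightarrow> nat \<Rightarrow> real" where
  "height h s i D = h i * real (days_since_trim s i D)"

definition makespan :: "nat \<Rightarrow> (nat \<Rightarrow> real) \<Rightarrow> schedule \<Rightarrow> ereal" where
  "makespan n h s = (SUP D. SUP i\<in>{..<n}. ereal (height h s i D))"


section \<open>Word RAM\<close>

text \<open>A machine has finitely many registers (those mentioned in its program) and \<open>S\<close> memory
  cells with addresses \<open>0, \<dots>, S - 1\<close>. Every register and every cell holds one signed integer
  of at most \<open>B\<close> bits. An instruction that would produce a larger number, access an address
  outside the memory, divide by zero, or take the logarithm of a nonpositive number has no
  successor configuration, so such a computation never halts. Numbers occupying \<open>c\<close> words of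
  \<open>w\<close> bits are modelled by \<open>B = c * w\<close>; the space in words is then \<open>c * S\<close> plus the constant
  number of registers.\<close>

datatype binop = Add | Sub | Mul | Div

datatype instr =
    Const nat int               \<comment> \<open>\<open>r := z\<close>\<close>
  | Arith binop nat nat nat     \<comment> \<open>\<open>r := x op y\<close>\<close>
  | FloorLog nat nat nat        \<comment> \<open>\<open>r := \<lfloor>log 2 (x / y)\<rfloor>\<close>\<close>
  | Load nat nat                \<comment> \<open>\<open>r := mem[a]\<close>\<close>
  | Store nat nat               \<comment> \<open>\<open>mem[a] := x\<close>\<close>
  | Jump nat
  | JumpLess nat nat nat        \<comment> \<open>\<open>if x < y then goto l\<close>\<close>

type_synonym program = "instr list"
type_synonym state = "(nat \<Rightarrow> int) \<times> (nat \<Rightarrow> int)"  \<comment> \<open>registers, memory\<close>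
type_synonym config = "nat \<times> state"               \<comment> \<open>program counter, state\<close>

fun arith :: "binop \<Rightarrow> int \<Rightarrow> int \<Rightarrow> int option" where
  "arith Add x y = Some (x + y)"
| "arith Sub x y = Some (x - y)"
| "arith Mul x y = Some (x * y)"
| "arith Div x y = (if y = 0 then None else Some (x div y))"

definition floor_log :: "int \<Rightarrow> int \<Rightarrow> int option" where
  "floor_log x y =
     (if 0 < x \<and> 0 < y then Some \<lfloor>log 2 (real_of_int x / real_of_int y)\<rfloor> else None)"

definition assign :: "nat \<Rightarrow> nat \<Rightarrow> int option \<Rightarrow> config \<Rightarrow> config option" where
  "assign B r v = (\<lambda>(pc, R, M).
     case v of
       None \<Rightarrow> None
     | Some z \<Rightarrow> if \<bar>z\<bar> < 2 ^ B then Some (Suc pc, R(r := z), M) else None)"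

fun exec :: "nat \<Rightarrow> nat \<Rightarrow> instr \<Rightarrow> config \<Rightarrow> config option" where
  "exec B S (Const r z) (pc, R, M) = assign B r (Some z) (pc, R, M)"
| "exec B S (Arith f r x y) (pc, R, M) = assign B r (arith f (R x) (R y)) (pc, R, M)"
| "exec B S (FloorLog r x y) (pc, R, M) = assign B r (floor_log (R x) (R y)) (pc, R, M)"
| "exec B S (Load r a) (pc, R, M) =
     (if 0 \<le> R a \<and> R a < int S then Some (Suc pc, R(r := M (nat (R a))), M) else None)"
| "exec B S (Store a x) (pc, R, M) =
     (if 0 \<le> R a \<and> R a < int S then Some (Suc pc, R, M(nat (R a) := R x)) else None)"
| "exec B S (Jump l) (pc, R, M) = Some (l, R, M)"
| "exec B S (JumpLess x y l) (pc, R, M) = Some (if R x < R y then l else Suc pc, R, M)"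

definition step :: "nat \<Rightarrow> nat \<Rightarrow> program \<Rightarrow> config \<Rightarrow> config \<Rightarrow> bool" where
  "step B S P c c' \<longleftrightarrow> fst c < length P \<and> exec B S (P ! fst c) c = Some c'"

text \<open>Started at its first instruction in state \<open>s\<close>, \<open>P\<close> leaves its code after exactly \<open>T\<close>
  instructions, in state \<open>s'\<close>.\<close>

definition halts_in :: "nat \<Rightarrow> nat \<Rightarrow> program \<Rightarrow> state \<Rightarrow> nat \<Rightarrow> state \<Rightarrow> bool" where
  "halts_in B S P s T s' \<longleftrightarrow>
     (\<exists>pc. (step B S P ^^ T) (0, s) (pc, s') \<and> length P \<le> pc)"


section \<open>Trimming oracles\<close>

text \<open>The growth rate of bamboo \<open>i\<close> is given as the fraction \<open>p i / q i\<close>, not necessarily in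
  lowest terms; \<open>n\<close> and all numerators and denominators have at most \<open>w\<close> bits.\<close>

definition encodes :: "nat \<Rightarrow> nat \<Rightarrow> (nat \<Rightarrow> real) \<Rightarrow> (nat \<Rightarrow> nat) \<Rightarrow> (nat \<Rightarrow> nat) \<Rightarrow> bool" where
  "encodes w n h p q \<longleftrightarrow>
     n < 2 ^ w \<and>
     (\<forall>i<n. p i < 2 ^ w \<and> 0 < q i \<and> q i < 2 ^ w \<and> h i = real (p i) / real (q i))"

text \<open>Initially register 0 contains \<open>n\<close> and the first \<open>2 * n\<close> cells contain
  \<open>p 0, q 0, p 1, q 1, \<dots>\<close>; everything else is zero.\<close>

definition input :: "nat \<Rightarrow> (nat \<Rightarrow> nat) \<Rightarrow> (nat \<Rightarrow> nat) \<Rightarrow> state" where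
  "input n p q =
     ((\<lambda>_. 0)(0 := int n),
      \<lambda>a. if a < 2 * n then int (if even a then p (a div 2) else q (a div 2)) else 0)"

text \<open>An oracle is a pair of programs. \<open>build\<close> is run once on the input; then \<open>query\<close> is run
  once per day, each time on the state left by the previous run, and leaves its answer in
  register 0. The day is not passed to \<open>query\<close>. Here \<open>T\<close> is the building time, \<open>t D\<close> the time
  of the query of day \<open>D\<close>, and \<open>ans D\<close> its answer; all of this takes place in a memory of
  \<open>S\<close> cells.\<close>

definition oracle_run ::
    "nat \<Rightarrow> nat \<Rightarrow> program \<Rightarrow> program \<Rightarrow> state \<Rightarrow> nat \<Rightarrow> (nat \<Rightarrow> nat) \<Rightarrow> (nat \<Rightarrow> nat) \<Rightarrow> bool" where
  "oracle_run B S build query s\<^sub>0 T t ans \<longleftrightarrow>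
     (\<exists>\<sigma>. halts_in B S build s\<^sub>0 T (\<sigma> 0) \<and>
          (\<forall>D. halts_in B S query (\<sigma> D) (t D) (\<sigma> (Suc D)) \<and>
               fst (\<sigma> (Suc D)) 0 = int (ans D)))"

end

theory Submission
  imports Defs
begin

text \<open>Write \<open>2 ^ - need i\<close> for \<open>h i\<close> rounded down to a power of two. Trimming bamboo \<open>i\<close> at
  least once in any \<open>2 ^ need i\<close> consecutive days keeps its height at most 2. The rounded rates
  sum to at most 1, so, taken in decreasing order, they are the lengths of disjoint dyadic
  subintervals of \<open>[0, 1)\<close>. On day \<open>D\<close> the oracle trims the bamboo whose interval contains the
  binary fraction obtained by reversing the bits of \<open>D\<close>: the leading \<open>k\<close> bits of this fraction are the
  last \<open>k\<close> bits of \<open>D\<close>, hence an interval of length \<open>2 ^ - k\<close> is hit once in every \<open>2 ^ k\<close> days.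

  A query is a binary search over the left endpoints followed by an increment of the reversed
  counter, which, as for an ordinary binary counter, takes amortized constant time.

  The exponents may be as large as the word length, which is not bounded in terms of \<open>n\<close>, so \<open>2 ^ need i\<close>
  cannot be computed by repeated doubling within the time allowed for building. Therefore the
  exponent is raised by only about \<open>log n\<close> from one bamboo to the next: once this cap applies, the
  part of \<open>[0, 1)\<close> still free has room for \<open>n\<close> intervals of the capped length. Sorting is done by
  repeatedly extracting the root of a tournament tree.\<close>

section \<open>Weakest preconditions for the word RAM\<close>

text \<open>A failing instruction has no successor, so the existence of a configuration after
  exactly \<open>t\<close> steps also rules out overflows and bad addresses.\<close>

definition wp ::
  "nat \<Rightarrow> nat \<Rightarrow> program \<Rightarrow> nat \<Rightarrow> config \<Rightarrow> (config \<Rightarrow> bool) \<Rightarrow> bool" where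
  "wp B S P t c Q \<longleftrightarrow> (\<exists>c'. (step B S P ^^ t) c c' \<and> Q c')"

definition instr_wp ::
  "nat \<Rightarrow> nat \<Rightarrow> instr \<Rightarrow> config \<Rightarrow> (config \<Rightarrow> bool) \<Rightarrow> bool" where
  "instr_wp B S i c Q \<longleftrightarrow> (\<exists>c'. exec B S i c = Some c' \<and> Q c')"

text \<open>Loops and branches compose by upper bounds on the number of steps; exact counts stay
  confined to straight-line code.\<close>

definition reach ::
  "nat \<Rightarrow> nat \<Rightarrow> program \<Rightarrow> nat \<Rightarrow> config \<Rightarrow> (config \<Rightarrow> bool) \<Rightarrow> bool" where
  "reach B S P t c Q \<longleftrightarrow> (\<exists>T\<le>t. wp B S P T c Q)"

lemma instr_wp_simps [simp]:
  "instr_wp B S (Const r z) (pc, R, M) Q \<longleftrightarrow> \<bar>z\<bar> < 2 ^ B \<and> Q (Suc pc, R(r := z), M)"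
  "instr_wp B S (Arith Add r x y) (pc, R, M) Q \<longleftrightarrow>
     \<bar>R x + R y\<bar> < 2 ^ B \<and> Q (Suc pc, R(r := R x + R y), M)"
  "instr_wp B S (Arith Sub r x y) (pc, R, M) Q \<longleftrightarrow>
     \<bar>R x - R y\<bar> < 2 ^ B \<and> Q (Suc pc, R(r := R x - R y), M)"
  "instr_wp B S (Arith Mul r x y) (pc, R, M) Q \<longleftrightarrow>
     \<bar>R x * R y\<bar> < 2 ^ B \<and> Q (Suc pc, R(r := R x * R y), M)"
  "instr_wp B S (Arith Div r x y) (pc, R, M) Q \<longleftrightarrow>
     R y \<noteq> 0 \<and> \<bar>R x div R y\<bar> < 2 ^ B \<and> Q (Suc pc, R(r := R x div R y), M)"
  "instr_wp B S (FloorLog r x y) (pc, R, M) Q \<longleftrightarrow>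
     0 < R x \<and> 0 < R y \<and> \<bar>\<lfloor>log 2 (R x / R y)\<rfloor>\<bar> < 2 ^ B \<and>
     Q (Suc pc, R(r := \<lfloor>log 2 (R x / R y)\<rfloor>), M)"
  "instr_wp B S (Load r a) (pc, R, M) Q \<longleftrightarrow>
     0 \<le> R a \<and> R a < int S \<and> Q (Suc pc, R(r := M (nat (R a))), M)"
  "instr_wp B S (Store a x) (pc, R, M) Q \<longleftrightarrow>
     0 \<le> R a \<and> R a < int S \<and> Q (Suc pc, R, M(nat (R a) := R x))"
  "instr_wp B S (Jump l) (pc, R, M) Q \<longleftrightarrow> Q (l, R, M)"
  "instr_wp B S (JumpLess x y l) (pc, R, M) Q \<longleftrightarrow>
     (R x < R y \<longrightarrow> Q (l, R, M)) \<and> (\<not> R x < R y \<longrightarrow> Q (Suc pc, R, M))"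
  by (auto simp: instr_wp_def assign_def floor_log_def split: if_splits)

lemma wp_0 [simp]: "wp B S P 0 c Q \<longleftrightarrow> Q c"
  by (simp add: wp_def)

lemma wp_Suc:
  "wp B S P (Suc t) (pc, R, M) Q \<longleftrightarrow>
     pc < length P \<and> instr_wp B S (P ! pc) (pc, R, M) (\<lambda>c. wp B S P t c Q)"
proof -
  have "(step B S P ^^ Suc t) c c' \<longleftrightarrow> (\<exists>d. step B S P c d \<and> (step B S P ^^ t) d c')" for c c'
    by (metis relpowp_Suc_D2 relpowp_Suc_I2)
  then show ?thesis
    unfolding wp_def instr_wp_def by (auto simp del: relpowp.simps split_paired_Ex simp: step_def)
qed

text \<open>Together with \<open>instr_wp_simps\<close> this lets the simplifier execute
  straight-line code symbolically.\<close>

lemma wp_numeral [simp]: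
  "wp B S P (numeral k) (pc, R, M) Q \<longleftrightarrow>
     pc < length P \<and> instr_wp B S (P ! pc) (pc, R, M) (\<lambda>c. wp B S P (pred_numeral k) c Q)"
  by (simp add: numeral_eq_Suc wp_Suc)

lemmas wp_1 [simp] = wp_Suc [where t = 0]

lemma reachI: "wp B S P T c Q \<Longrightarrow> T \<le> t \<Longrightarrow> reach B S P t c Q"
  by (auto simp: reach_def)

lemma reach_refl: "Q c \<Longrightarrow> reach B S P t c Q"
  by (rule reachI[of _ _ _ 0]) auto

lemma reach_trans:
  assumes "reach B S P t c Q" "\<And>c'. Q c' \<Longrightarrow> reach B S P t' c' Q'" "t + t' \<le> u"
  shows "reach B S P u c Q'"
proof -
  obtain T c' where 1: "T \<le> t" "(step B S P ^^ T) c c'" "Q c'"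
    using assms(1) by (auto simp: reach_def wp_def)
  obtain T' c'' where 2: "T' \<le> t'" "(step B S P ^^ T') c' c''" "Q' c''"
    using assms(2)[OF 1(3)] by (auto simp: reach_def wp_def)
  have "(step B S P ^^ (T + T')) c c''"
    using 1(2) 2(2) by (auto simp: relpowp_add)
  moreover have "T + T' \<le> u" using 1(1) 2(1) assms(3) by simp
  ultimately show ?thesis using 2(3) unfolding reach_def wp_def by blast
qed

lemma reach_mono:
  assumes "reach B S P t c Q" "\<And>c'. Q c' \<Longrightarrow> Q' c'" "t \<le> u"
  shows "reach B S P u c Q'"
  using reach_trans[OF assms(1) reach_refl[of Q' _ _ _ _ 0]] assms(2,3) by simp

text \<open>Loop rule. \<open>I\<close> may constrain the program counter, so \<open>I m\<close> can
  name the exit address.\<close>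

lemma reach_iterate:
  assumes "\<And>i c. i < m \<Longrightarrow> I i c \<Longrightarrow> reach B S P t c (I (Suc i))" "i \<le> m" "I i c"
  shows "reach B S P (t * (m - i)) c (I m)"
  using assms(2,3)
proof (induction "m - i" arbitrary: i c)
  case 0
  then show ?case by (simp add: reach_refl)
next
  case (Suc d)
  have i: "i < m" "m - i = Suc (m - Suc i)" using Suc.hyps(2) by auto
  have "reach B S P (t * (m - Suc i)) c' (I m)" if "I (Suc i) c'" for c'
    using Suc.hyps(1)[of "Suc i" c'] Suc.hyps(2) that i by simp
  from reach_trans[OF assms(1)[OF i(1) Suc.prems(2)] this] show ?case by (simp add: i(2))
qed

lemma reach_halts:
  assumes "reach B S P t (0, s) (\<lambda>(pc, s'). length P \<le> pc \<and> Q s')"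
  shows "\<exists>T\<le>t. \<exists>s'. halts_in B S P s T s' \<and> Q s'"
  using assms by (fastforce simp: reach_def wp_def halts_in_def)


section \<open>Bit reversal\<close>

fun bitrev :: "nat \<Rightarrow> nat \<Rightarrow> nat" where
  "bitrev 0 D = 0"
| "bitrev (Suc k) D = D mod 2 * 2 ^ k + bitrev k (D div 2)"

text \<open>The number of carries when \<open>D\<close> is incremented, as a \<open>k\<close>-bit number.\<close>

fun carries :: "nat \<Rightarrow> nat \<Rightarrow> nat" where
  "carries 0 D = 0"
| "carries (Suc k) D = (if even D then 0 else Suc (carries k (D div 2)))"

lemma bitrev_less: "bitrev k D < 2 ^ k"
proof (induction k arbitrary: D)
  case (Suc k)
  have "D mod 2 * 2 ^ k \<le> 1 * 2 ^ k" by (intro mult_right_mono) auto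
  then have "D mod 2 * 2 ^ k + bitrev k (D div 2) < 1 * 2 ^ k + 2 ^ k"
    by (intro add_le_less_mono Suc)
  then show ?case by simp
qed simp

lemma bitrev_zero [simp]: "bitrev k 0 = 0"
  by (induction k) auto

text \<open>The leading \<open>k\<close> bits of the reversal come from the last \<open>k\<close>
  bits of \<open>D\<close>, whatever \<open>K\<close> is.\<close>

lemma bitrev_div: "k \<le> K \<Longrightarrow> bitrev K D div 2 ^ (K - k) = bitrev k D"
proof (induction k arbitrary: K D)
  case 0
  then show ?case by (simp add: bitrev_less)
next
  case (Suc k)
  then obtain K' where K: "K = Suc K'" "k \<le> K'" by (cases K) auto
  have "(2::nat) ^ K' = 2 ^ k * 2 ^ (K' - k)"
    using K by (simp flip: power_add)
  then have "bitrev K D = bitrev K' (D div 2) + (D mod 2 * 2 ^ k) * 2 ^ (K' - k)"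
    using K(1) by (simp add: ac_simps)
  then show ?case using Suc.IH[OF K(2), of "D div 2"] K(1)
    by (simp del: bitrev.simps add: bitrev.simps(2)[of k])
qed

text \<open>The leading bit \<open>b\<close> of \<open>y\<close> fixes the parity of
  \<open>D = 2 * E + b\<close>, and \<open>E\<close> then ranges over a window of half the
  length.\<close>

lemma bitrev_window:
  "y < 2 ^ k \<Longrightarrow> \<exists>D\<ge>a. D < a + 2 ^ k \<and> bitrev k D = y"
proof (induction k arbitrary: y a)
  case (Suc k)
  define b where "b = y div 2 ^ k"
  have b: "b = 0 \<or> b = 1" using less_mult_imp_div_less[of y 2 "2 ^ k"] Suc.prems
    unfolding b_def by auto
  have y: "y = b * 2 ^ k + y mod 2 ^ k" unfolding b_def by (rule div_mult_mod_eq [symmetric])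
  \<comment> \<open>\<open>(a + 1 - b) div 2\<close> is the least \<open>E\<close> with
    \<open>a \<le> 2 * E + b\<close>.\<close>
  obtain E where E: "(a + 1 - b) div 2 \<le> E" "E < (a + 1 - b) div 2 + 2 ^ k"
    "bitrev k E = y mod 2 ^ k"
    using Suc.IH[of "y mod 2 ^ k" "(a + 1 - b) div 2"] by auto
  have "bitrev (Suc k) (2 * E + b) = y" using b E(3) y by auto
  moreover have "a \<le> 2 * E + b" using b E(1) by auto
  moreover have "2 * E + b < a + 2 ^ Suc k" using b E(2) by auto
  ultimately show ?case by blast
qed auto

text \<open>Only odd \<open>D = 2 * E + 1\<close> carry, each costing 1 plus the carries of
  \<open>E\<close>. This gives \<open>m div 2\<close> plus, by induction, at most
  \<open>m div 2\<close>.\<close>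

lemma sum_carries: "(\<Sum>D<m. carries k D) \<le> m"
proof (induction k arbitrary: m)
  case (Suc k)
  have split: "(\<Sum>D<m. carries (Suc k) D) = (\<Sum>E<m div 2. Suc (carries k E))"
  proof (induction m)
    case (Suc m)
    then show ?case by (cases "even m") auto
  qed simp
  also have "\<dots> = m div 2 + (\<Sum>E<m div 2. carries k E)"
    by (simp only: Suc_eq_plus1_left sum.distrib) simp
  also have "\<dots> \<le> m" using Suc.IH[of "m div 2"] by linarith
  finally show ?case .
qed simp


section \<open>Dyadic intervals\<close>

definition prev :: "(nat \<Rightarrow> nat) \<Rightarrow> nat \<Rightarrow> nat" where
  "prev k j = (case j of 0 \<Rightarrow> 0 | Suc i \<Rightarrow> k i)"

lemma prev_simps [simp]: "prev k 0 = 0" "prev k (Suc i) = k i"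
  by (simp_all add: prev_def)

text \<open>\<open>f\<close> are the required exponents, \<open>k\<close> the exponents actually used.\<close>

definition capped ::
  "nat \<Rightarrow> (nat \<Rightarrow> nat) \<Rightarrow> (nat \<Rightarrow> nat) \<Rightarrow> nat \<Rightarrow> bool" where
  "capped n f k m \<longleftrightarrow>
     (\<forall>j<m. prev k j \<le> k j \<and> k j \<le> f j \<and> (k j = f j \<or> n * 2 ^ prev k j \<le> 2 ^ k j))"

lemma capped_mono:
  assumes "capped n f k m" "i \<le> j" "j < m"
  shows "k i \<le> k j"
  using assms(2,3)
proof (induction j rule: dec_induct)
  case (step j)
  then have "prev k (Suc j) \<le> k (Suc j)"
    using assms(1) unfolding capped_def by blast
  with step show ?case by simp
qed simp

lemma prev_mono:
  assumes "capped n f k m" "i < j" "j < m"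
  shows "k i \<le> prev k j"
  using assms capped_mono[OF assms(1), of i "j - 1"] by (cases j) auto

text \<open>Over the common denominator \<open>2 ^ K\<close>, comparing the sum with 1 becomes
  comparing natural numbers.\<close>

lemma sum_halves:
  assumes "\<And>i. i < j \<Longrightarrow> k i \<le> K"
  shows "(\<Sum>i<j. (1 / 2 :: real) ^ k i) = real (\<Sum>i<j. 2 ^ (K - k i)) / 2 ^ K"
proof -
  have "(1 / 2 :: real) ^ k i = 2 ^ (K - k i) / 2 ^ K" if "i < j" for i
    using assms[OF that] by (simp add: power_diff power_one_over)
  then show ?thesis by (simp add: sum_divide_distrib)
qed

text \<open>The partial sum before the first capped index is below 1 and a multiple of
  \<open>2 ^ - prev k j\<close>, so it leaves room for \<open>n\<close> terms of size at most \<open>2 ^ - prev k j / n\<close>.\<close>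

lemma kraft_capped:
  assumes c: "capped n f k n" and f: "(\<Sum>j<n. (1 / 2 :: real) ^ f j) \<le> 1"
  shows "(\<Sum>j<n. (1 / 2 :: real) ^ k j) \<le> 1"
proof (cases "\<forall>j<n. k j = f j")
  case True
  with f show ?thesis by simp
next
  case False
  define j where "j = (LEAST j. j < n \<and> k j \<noteq> f j)"
  have j: "j < n" "k j \<noteq> f j" and before: "\<And>i. i < j \<Longrightarrow> k i = f i"
  proof -
    have *: "j < n \<and> k j \<noteq> f j"
      unfolding j_def by (rule LeastI_ex) (use False in blast)
    then show "j < n" "k j \<noteq> f j" by auto
    show "k i = f i" if "i < j" for i
      using not_less_Least[OF that[unfolded j_def]] * that by auto
  qed
  define K where "K = prev k j"
  have split: "sum g {..<n} = sum g {..<j} + sum g {j..<n}" for g :: "nat \<Rightarrow> real"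
    using sum.atLeastLessThan_concat[of 0 j n g] j(1) by (simp add: lessThan_atLeast0)
  have K: "k i \<le> K" if "i < j" for i
    using prev_mono[OF c that j(1)] by (simp add: K_def)
  \<comment> \<open>The tail starting at \<open>j\<close> is nonempty, so the sum of the terms
    before it is strictly below 1. Integrality turns this into a free gap of
    \<open>1 / 2 ^ K\<close>.\<close>
  have "0 < (\<Sum>i\<in>{j..<n}. (1 / 2 :: real) ^ f i)"
    using j(1) by (intro sum_pos) auto
  then have lt1: "(\<Sum>i<j. (1 / 2 :: real) ^ k i) < 1"
    using f split[of "\<lambda>i. (1 / 2) ^ f i"] before by simp
  define N where "N = (\<Sum>i<j. 2 ^ (K - k i) :: nat)"
  have N: "(\<Sum>i<j. (1 / 2 :: real) ^ k i) = real N / 2 ^ K"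
    unfolding N_def using K by (rule sum_halves)
  have "N < 2 ^ K" using lt1 by (simp add: N)
  then have "real (N + 1) \<le> 2 ^ K"
    by (subst of_nat_le_numeral_power_cancel_iff) simp
  then have 1: "(\<Sum>i<j. (1 / 2 :: real) ^ k i) + 1 / 2 ^ K \<le> 1"
    unfolding N by (simp add: field_simps)
  have "n * 2 ^ K \<le> 2 ^ k j" using c j by (auto simp: capped_def K_def)
  then have "real (n * 2 ^ K) \<le> real (2 ^ k j)" by (simp only: of_nat_le_iff)
  then have nK: "real n * 2 ^ K \<le> 2 ^ k j" by simp
  have "(\<Sum>i\<in>{j..<n}. (1 / 2 :: real) ^ k i) \<le> (\<Sum>i\<in>{j..<n}. 1 / (real n * 2 ^ K))"
  proof (rule sum_mono)
    fix i assume "i \<in> {j..<n}"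
    then have "(1 / 2 :: real) ^ k i \<le> (1 / 2) ^ k j"
      using capped_mono[OF c, of j i] by (intro power_decreasing) auto
    also have "\<dots> \<le> 1 / (real n * 2 ^ K)"
      using nK j(1) by (simp add: power_one_over frac_le)
    finally show "(1 / 2 :: real) ^ k i \<le> 1 / (real n * 2 ^ K)" .
  qed
  also have "\<dots> = real (n - j) / real n * (1 / 2 ^ K)" by simp
  also have "\<dots> \<le> 1 * (1 / 2 ^ K)" by (intro mult_right_mono) (auto simp: divide_le_eq_1)
  finally show ?thesis using 1 unfolding split by linarith
qed

text \<open>Left endpoint of the \<open>j\<close>-th interval, in units of \<open>2 ^ - K\<close>.\<close>

definition slot_start :: "(nat \<Rightarrow> nat) \<Rightarrow> nat \<Rightarrow> nat \<Rightarrow> nat" where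
  "slot_start k K j = (\<Sum>i<j. 2 ^ (K - k i))"

lemma slot_start_0 [simp]: "slot_start k K 0 = 0"
  by (simp add: slot_start_def)

lemma slot_start_Suc: "slot_start k K (Suc j) = slot_start k K j + 2 ^ (K - k j)"
  by (simp add: slot_start_def)

lemma slot_start_less: "i < j \<Longrightarrow> slot_start k K i < slot_start k K j"
  by (rule lift_Suc_mono_less) (simp_all add: slot_start_Suc)

text \<open>Points beyond the last interval count as hits of the last one, so every day has an
  answer even if the lengths sum to less than 1.\<close>

definition slot ::
  "nat \<Rightarrow> (nat \<Rightarrow> nat) \<Rightarrow> nat \<Rightarrow> nat \<Rightarrow> nat" where
  "slot n k K x = Max {j. j < n \<and> slot_start k K j \<le> x}"

lemma slot_eqI:
  assumes "j < n" "slot_start k K j \<le> x" "Suc j < n \<Longrightarrow> x < slot_start k K (Suc j)"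
  shows "slot n k K x = j"
  unfolding slot_def
proof (rule Max_eqI)
  fix i assume i: "i \<in> {j. j < n \<and> slot_start k K j \<le> x}"
  show "i \<le> j"
  proof (rule ccontr)
    assume "\<not> i \<le> j"
    then have "Suc j \<le> i" by simp
    then have "slot_start k K (Suc j) \<le> slot_start k K i"
      using slot_start_less[of "Suc j" i k K] by (cases "Suc j = i") auto
    with i assms(3) \<open>Suc j \<le> i\<close> show False by auto
  qed
qed (use assms in auto)

lemma slot_less: "0 < n \<Longrightarrow> slot n k K x < n"
  unfolding slot_def by (subst Max_less_iff) (auto intro: exI[of _ 0])

lemma slot_start_le:
  assumes "(\<Sum>j<n. (1 / 2 :: real) ^ k j) \<le> 1" "\<And>i. i < n \<Longrightarrow> k i \<le> K" "j \<le> n"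
  shows "slot_start k K j \<le> 2 ^ K"
proof -
  have "(\<Sum>j<n. (1 / 2 :: real) ^ k j) = real (slot_start k K n) / 2 ^ K"
    unfolding slot_start_def using assms(2) by (rule sum_halves)
  with assms(1) have "slot_start k K n \<le> 2 ^ K" by simp
  moreover have "slot_start k K j \<le> slot_start k K n"
    using slot_start_less[of j n k K] assms(3) by (cases "j = n") auto
  ultimately show ?thesis by simp
qed

text \<open>Exponents never decrease, so earlier lengths, and hence the left endpoint, are multiples
  of the length of interval \<open>j\<close>. The interval thus consists of all \<open>K\<close>-bit
  numbers with one fixed pattern of leading \<open>k j\<close> bits, and
  \<open>bitrev_window\<close> applies.\<close>

lemma slot_window:
  assumes c: "capped n f k n" and kraft: "(\<Sum>j<n. (1 / 2 :: real) ^ k j) \<le> 1"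
    and j: "j < n" and K: "\<And>i. i < n \<Longrightarrow> k i \<le> K"
  shows "\<exists>D\<ge>a. D < a + 2 ^ k j \<and> slot n k K (bitrev K D) = j"
proof -
  let ?s = "2 ^ (K - k j) :: nat"
  have "?s dvd 2 ^ (K - k i)" if "i < j" for i
    using capped_mono[OF c, of i j] that j by (intro le_imp_power_dvd) auto
  then have dvd: "?s dvd slot_start k K j"
    unfolding slot_start_def by (intro dvd_sum) auto
  have "slot_start k K n \<le> 2 ^ K" using slot_start_le[OF kraft K] by simp
  with slot_start_less[OF j, of k K] have "slot_start k K j < 2 ^ K" by simp
  also have "(2 :: nat) ^ K = 2 ^ k j * ?s" using K[OF j] by (simp flip: power_add)
  finally have "slot_start k K j div ?s < 2 ^ k j" by (simp add: less_mult_imp_div_less)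
  from bitrev_window[OF this, of a] obtain D where
    D: "a \<le> D" "D < a + 2 ^ k j" "bitrev (k j) D = slot_start k K j div ?s" by blast
  have "bitrev K D div ?s = slot_start k K j div ?s"
    using D(3) bitrev_div[OF K[OF j], of D] by simp
  then have "bitrev K D = slot_start k K j + bitrev K D mod ?s"
    using dvd_div_mult_self[OF dvd] div_mult_mod_eq[of "bitrev K D" ?s] by simp
  moreover have "bitrev K D mod ?s < ?s" by simp
  ultimately have "slot_start k K j \<le> bitrev K D" "bitrev K D < slot_start k K j + ?s"
    by linarith+
  then have "slot n k K (bitrev K D) = j"
    using j by (intro slot_eqI) (auto simp: slot_start_Suc)
  with D show ?thesis by blast
qed

section \<open>From regular trimming to the makespan\<close>

lemma days_since_trim_le:
  assumes "\<And>a. \<exists>D\<ge>a. D < a + P \<and> s D = Some i"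
  shows "days_since_trim s i D \<le> P"
proof (cases "\<exists>d<D. s d = Some i")
  case True
  define m where "m = Max {d. d < D \<and> s d = Some i}"
  \<comment> \<open>The window opens on the day after the last trim before \<open>D\<close>, so the
    trim found in it is on day \<open>D\<close> or later.\<close>
  obtain d where d: "Suc m \<le> d" "d < Suc m + P" "s d = Some i"
    using assms[of "Suc m"] by blast
  have "\<not> d < D"
  proof
    assume "d < D"
    with d(3) have "d \<le> m" unfolding m_def by (intro Max_ge) auto
    with d(1) show False by simp
  qed
  with d True show ?thesis by (simp add: days_since_trim_def m_def)
next
  case False
  obtain d where "d < P" "s d = Some i" using assms[of 0] by auto
  with False have "D \<le> d" by (meson not_le)
  with \<open>d < P\<close> False show ?thesis by (auto simp: days_since_trim_def)
qed

lemma makespan_leI: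
  assumes "\<And>i. i < n \<Longrightarrow> 0 \<le> h i \<and> h i * real (P i) \<le> H"
    and "\<And>i a. i < n \<Longrightarrow> \<exists>D\<ge>a. D < a + P i \<and> s D = Some i"
  shows "makespan n h s \<le> ereal H"
  unfolding makespan_def
proof (intro SUP_least)
  fix D i assume i: "i \<in> {..<n}"
  then have "days_since_trim s i D \<le> P i" using assms(2) by (intro days_since_trim_le) auto
  then have "height h s i D \<le> h i * real (P i)"
    unfolding height_def using assms(1) i by (intro mult_left_mono) auto
  also have "\<dots> \<le> H" using assms(1) i by simp
  finally show "ereal (height h s i D) \<le> ereal H" by simp
qed


section \<open>The oracle\<close>

text \<open>Register 0 holds \<open>n\<close> on entry to building and later the answers, hence the
  copy in \<open>rN\<close>. As the only comparison is strict, \<open>rNeg\<close> and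
  \<open>rNP\<close> hold -1 and \<open>n - 1\<close> for testing \<open>0 \<le> y\<close> and
  \<open>n \<le> y\<close>.\<close>

abbreviation (input) "rOut \<equiv> 0 :: nat"
abbreviation (input) "rN \<equiv> 1 :: nat"
abbreviation (input) "rN2 \<equiv> 2 :: nat"
abbreviation (input) "rN3 \<equiv> 3 :: nat"
abbreviation (input) "rOne \<equiv> 4 :: nat"
abbreviation (input) "rTwo \<equiv> 5 :: nat"
abbreviation (input) "rNeg \<equiv> 6 :: nat"
abbreviation (input) "rNP \<equiv> 7 :: nat"
abbreviation (input) "rZero \<equiv> 8 :: nat"
abbreviation (input) "rAdr \<equiv> 9 :: nat"
abbreviation (input) "rIdx \<equiv> 10 :: nat"
abbreviation (input) "rX \<equiv> 11 :: nat"
abbreviation (input) "rY \<equiv> 12 :: nat"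
abbreviation (input) "rLog \<equiv> 13 :: nat"
abbreviation (input) "rDead \<equiv> 14 :: nat"
abbreviation (input) "rCur \<equiv> 15 :: nat"
abbreviation (input) "rScale \<equiv> 16 :: nat"
abbreviation (input) "rGap \<equiv> 17 :: nat"
abbreviation (input) "rNode \<equiv> 18 :: nat"
abbreviation (input) "rBam \<equiv> 19 :: nat"
abbreviation (input) "rPos \<equiv> 20 :: nat"
abbreviation (input) "rHalf \<equiv> 21 :: nat"
abbreviation (input) "rLo \<equiv> 22 :: nat"
abbreviation (input) "rHi \<equiv> 23 :: nat"
abbreviation (input) "rBit \<equiv> 24 :: nat"

text \<open>The numbers in the comments are the addresses of jump targets. Memory layout while building:
  cell \<open>2 * n + v\<close> holds node \<open>v\<close> of the tournament tree, whose leaves are \<open>n, \<dots>, 2 * n - 1\<close>.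
  The input is overwritten: cell \<open>j\<close> becomes the \<open>j\<close>-th extracted bamboo, cell \<open>n + j\<close> first the
  reciprocal of the length of its interval, then the scaled left endpoint of that interval.
  \<open>rScale\<close> is 2 to the power \<open>rCur\<close>, the exponent of the current bamboo, and \<open>rGap\<close> is 2 to the power
  of the increase of the exponent since the previous bamboo, which stops growing once it reaches \<open>n\<close>.\<close>

definition build_prog :: program where
  "build_prog =
    [Const rOne 1,
     Const rTwo 2,
     Const rNeg (- 1),
     Arith Add rN rOut rZero,
     Arith Add rN2 rN rN,
     Arith Add rN3 rN2 rN,
     Arith Sub rNP rN rOne,
     Arith Add rDead rNeg rZero,
     Arith Add rAdr rIdx rIdx, \<comment> \<open>8\<close>
     Load rX rAdr,
     Arith Add rAdr rAdr rOne,
     Load rY rAdr,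
     FloorLog rLog rX rY,
     Arith Add rDead rDead rLog,
     Arith Mul rX rLog rN,
     Arith Add rX rX rIdx,
     Arith Add rAdr rN3 rIdx,
     Store rAdr rX,
     Arith Add rIdx rIdx rOne,
     JumpLess rIdx rN 8,
     Arith Mul rDead rDead rN,
     Arith Add rNode rNP rZero,
     JumpLess rNode rOne 34, \<comment> \<open>22\<close>
     Arith Add rAdr rNode rNode,
     Arith Add rAdr rAdr rN2,
     Load rX rAdr,
     Arith Add rAdr rAdr rOne,
     Load rY rAdr,
     JumpLess rY rX 30,
     Load rX rAdr,
     Arith Add rAdr rN2 rNode, \<comment> \<open>30\<close>
     Store rAdr rX,
     Arith Sub rNode rNode rOne,
     Jump 22,
     Const rIdx 0, \<comment> \<open>34\<close>
     Const rScale 1,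
     Arith Add rAdr rN2 rOne, \<comment> \<open>36\<close>
     Load rX rAdr,
     Arith Div rLog rX rN,
     Arith Mul rY rLog rN,
     Arith Sub rBam rX rY,
     Store rIdx rBam,
     Const rGap 1,
     JumpLess rNP rGap 50, \<comment> \<open>43\<close>
     Arith Add rY rCur rLog,
     JumpLess rNeg rY 50,
     Arith Add rScale rScale rScale,
     Arith Add rGap rGap rGap,
     Arith Add rCur rCur rOne,
     Jump 43,
     Arith Add rAdr rN rIdx, \<comment> \<open>50\<close>
     Store rAdr rScale,
     Arith Add rNode rN rBam,
     Arith Add rAdr rN2 rNode,
     Store rAdr rDead,
     Arith Div rNode rNode rTwo, \<comment> \<open>55\<close>
     JumpLess rNode rOne 67,
     Arith Add rAdr rNode rNode,
     Arith Add rAdr rAdr rN2,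
     Load rX rAdr,
     Arith Add rAdr rAdr rOne,
     Load rY rAdr,
     JumpLess rY rX 64,
     Load rX rAdr,
     Arith Add rAdr rN2 rNode, \<comment> \<open>64\<close>
     Store rAdr rX,
     Jump 55,
     Arith Add rIdx rIdx rOne, \<comment> \<open>67\<close>
     JumpLess rIdx rN 36,
     Const rIdx 0,
     Arith Add rAdr rN rIdx, \<comment> \<open>70\<close>
     Load rY rAdr,
     Store rAdr rPos,
     Arith Div rY rScale rY,
     Arith Add rPos rPos rY,
     Arith Add rIdx rIdx rOne,
     JumpLess rIdx rN 70,
     Const rPos 0,
     Arith Div rHalf rScale rTwo]"

text \<open>The search keeps the slot in the half-open range from \<open>rLo\<close> to
  \<open>rHi\<close>. As \<open>rPos\<close> is bit-reversed, the increment starts at its top bit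
  and clears ones downwards; if all bits were ones, \<open>rBit\<close> reaches 0 and the final
  addition adds nothing.\<close>

definition query_prog :: program where
  "query_prog =
    [Const rLo 0,
     Arith Add rHi rN rZero,
     Arith Sub rY rHi rLo, \<comment> \<open>2\<close>
     JumpLess rY rTwo 13,
     Arith Add rY rLo rHi,
     Arith Div rY rY rTwo,
     Arith Add rAdr rN rY,
     Load rX rAdr,
     JumpLess rPos rX 11,
     Arith Add rLo rY rZero,
     Jump 2,
     Arith Add rHi rY rZero, \<comment> \<open>11\<close>
     Jump 2,
     Load rOut rLo, \<comment> \<open>13\<close>
     Arith Add rBit rHalf rZero,
     JumpLess rPos rBit 19, \<comment> \<open>15\<close>
     Arith Sub rPos rPos rBit,
     Arith Div rBit rBit rTwo,
     JumpLess rZero rBit 15,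
     Arith Add rPos rPos rBit] \<comment> \<open>19\<close>"

lemma length_build [simp]: "length build_prog = 79"
  by (simp add: build_prog_def)

lemma length_query [simp]: "length query_prog = 20"
  by (simp add: query_prog_def)

lemma nat_address [simp]:
  "nat (int a + int b) = a + b"
  "nat (int a + 1) = a + 1"
  "nat (numeral k * int a) = numeral k * a"
  "nat (numeral k * int a + 1) = numeral k * a + 1"
  "nat (numeral k * int a + int b) = numeral k * a + b"
  "nat (numeral k * int a + numeral l * int b) = numeral k * a + numeral l * b"
  "nat (numeral k * int a + numeral l * int b + 1) = numeral k * a + numeral l * b + 1"
  by (simp_all add: nat_add_distrib nat_mult_distrib)

section \<open>Rounded growth rates, word size and sorting keys\<close>

locale bgt_input =
  fixes w n :: nat and h :: "nat \<Rightarrow> real" and p q :: "nat \<Rightarrow> nat"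
  assumes inst: "bgt_instance n h" and enc: "encodes w n h p q"
begin

lemma n_pos: "0 < n"
  using inst by (cases n) (auto simp: bgt_instance_def)

lemma n_less: "n < 2 ^ w"
  using enc by (simp add: encodes_def)

lemma w_pos: "0 < w"
  using n_pos n_less by (cases w) auto

lemma h_pos: "i < n \<Longrightarrow> 0 < h i"
  using inst by (simp add: bgt_instance_def)

lemma h_le_1: "i < n \<Longrightarrow> h i \<le> 1"
  using inst member_le_sum[of i "{..<n}" h] by (force simp: bgt_instance_def)

lemma rate:
  assumes "i < n"
  shows "h i = real (p i) / real (q i)" "0 < p i" "0 < q i" "p i < 2 ^ w" "q i < 2 ^ w"
  using enc assms h_pos[OF assms] by (auto simp: encodes_def intro!: Nat.gr0I)

definition need :: "nat \<Rightarrow> nat" where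
  "need i = nat (- \<lfloor>log 2 (h i)\<rfloor>)"

lemma floor_log_h: "i < n \<Longrightarrow> \<lfloor>log 2 (h i)\<rfloor> = - int (need i)"
  using h_le_1[of i] h_pos[of i] by (simp add: need_def floor_le_iff)

lemma floor_log_rate: "i < n \<Longrightarrow> \<lfloor>log 2 (real (p i) / real (q i))\<rfloor> = - int (need i)"
  using floor_log_h[of i] rate(1)[of i] by simp

lemma h_bounds:
  assumes "i < n"
  shows "(1 / 2) ^ need i \<le> h i" "h i * 2 ^ need i \<le> 2"
proof -
  have "- real (need i) \<le> log 2 (h i)" "log 2 (h i) < 1 - real (need i)"
    using floor_log_h[OF assms] by linarith+
  then have "2 powr - real (need i) \<le> h i" "h i < 2 powr (1 - real (need i))"
    using h_pos[OF assms] by (auto simp: le_log_iff log_less_iff)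
  then show "(1 / 2) ^ need i \<le> h i" "h i * 2 ^ need i \<le> 2"
    by (auto simp: powr_minus powr_diff powr_realpow power_one_over field_simps)
qed

text \<open>A positive fraction with denominator below \<open>2 ^ w\<close> exceeds
  \<open>2 ^ - w\<close>.\<close>

lemma need_le: "i < n \<Longrightarrow> need i \<le> w"
proof -
  assume i: "i < n"
  have "2 ^ need i * real (p i) \<le> real (q i) * 2"
    using h_bounds(2)[OF i] rate[OF i] by (simp add: field_simps)
  moreover have "1 \<le> real (p i)" using rate[OF i] by simp
  then have "2 ^ need i * 1 \<le> 2 ^ need i * real (p i)"
    by (intro mult_left_mono) auto
  moreover have "real (q i) < 2 ^ w" using rate[OF i] by simp
  ultimately have "(2 :: real) ^ need i < 2 ^ Suc w" unfolding power_Suc by linarith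
  then have "need i < Suc w" by (subst (asm) power_strict_increasing_iff) auto
  then show ?thesis by simp
qed

abbreviation "B \<equiv> 4 * w"
abbreviation "S \<equiv> 4 * n"
abbreviation "runs P t c Q \<equiv> reach B S P t c Q"

text \<open>Dominates every address and every key; all other numbers are powers of two up to \<open>2 ^ w\<close>,
  input data, or bounded by these.\<close>

lemma word_bound:
  "int n * (int n * int w) + 5 * int n + 4 < 2 ^ B" "0 \<le> int n * (int n * int w)"
  "int w \<le> int n * int w" "int n * int w \<le> int n * (int n * int w)"
proof -
  \<comment> \<open>\<open>n\<close> and \<open>w\<close> are at most \<open>U - 1\<close>, so the
    cubic term plus \<open>n\<close> is below \<open>U ^ 3\<close>. The rest is at most
    \<open>4 * U\<close>, and one further factor \<open>U\<close> absorbs it.\<close>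
  define U where "U = (2 :: int) ^ w"
  have "int n < int (2 ^ w)" "int w < int (2 ^ w)"
    using n_less less_exp[of w] by (simp_all only: of_nat_less_iff)
  then have n: "int n + 1 \<le> U" and w: "int w + 1 \<le> U"
    unfolding U_def of_nat_power of_nat_numeral by linarith+
  have U: "2 \<le> U" using n n_pos by simp
  have "int n * int w + 1 \<le> (U - 1) * (U - 1) + 1"
    using n w by (intro add_right_mono mult_mono) auto
  also have "\<dots> \<le> U * U" using U by (simp add: algebra_simps)
  finally have "int n * (int n * int w + 1) \<le> (U - 1) * (U * U)"
    using n by (intro mult_mono) auto
  also have "\<dots> < U * U * U" using U by (simp add: algebra_simps)
  finally have "int n * (int n * int w) + int n < U * U * U" by (simp add: distrib_left)
  moreover have "4 * U \<le> U * U * U" using mult_mono[OF U U] U by (intro mult_right_mono) auto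
  moreover have "2 * (U * U * U) \<le> U * (U * U * U)" using U by (intro mult_right_mono) auto
  moreover have "2 ^ B = U * (U * U * U)"
    by (simp add: U_def mult.commute[of 4] power_mult power4_eq_xxxx ac_simps)
  ultimately show "int n * (int n * int w) + 5 * int n + 4 < 2 ^ B"
    using n by linarith
  show "int w \<le> int n * int w"
    using n_pos mult_right_mono[of 1 "int n" "int w"] by simp
  show "int n * int w \<le> int n * (int n * int w)"
    using n_pos mult_right_mono[of 1 "int n" "int n * int w"] by simp
qed simp_all

lemma rate_bound: "i < n \<Longrightarrow> int (p i) < 2 ^ B" "i < n \<Longrightarrow> int (q i) < 2 ^ B"
proof -
  have "(2 :: int) ^ w \<le> 2 ^ B" by (intro power_increasing) auto
  moreover have "int (p i) < 2 ^ w \<and> int (q i) < 2 ^ w" if "i < n"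
    using rate(4,5)[OF that] by (metis of_nat_less_iff of_nat_numeral of_nat_power)
  ultimately show "i < n \<Longrightarrow> int (p i) < 2 ^ B" "i < n \<Longrightarrow> int (q i) < 2 ^ B"
    by (meson order_less_le_trans)+
qed

text \<open>Larger keys mean smaller needs; the index breaks ties and is the remainder modulo \<open>n\<close>.\<close>

definition key :: "nat \<Rightarrow> int" where
  "key i = - int (need i) * int n + int i"

text \<open>A key below all others, marking the leaves of extracted bamboos.\<close>

definition dead_key :: int where
  "dead_key = (- 1 - (\<Sum>i<n. int (need i))) * int n"

lemma sum_need_le: "i \<le> n \<Longrightarrow> (\<Sum>k<i. int (need k)) \<le> int n * int w"
proof -
  assume i: "i \<le> n"
  have "(\<Sum>k<i. int (need k)) \<le> (\<Sum>k<i. int w)"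
    using i need_le by (intro sum_mono) auto
  also have "\<dots> \<le> int n * int w" using i by (simp add: mult_right_mono)
  finally show ?thesis .
qed

lemma need_bound:
  "i < n \<Longrightarrow> int (need i) * int n \<le> int n * (int n * int w)" "0 \<le> int (need i) * int n"
proof -
  assume i: "i < n"
  have "int (need i) * int n \<le> int w * int n"
    using need_le[OF i] by (intro mult_right_mono) auto
  also have "\<dots> \<le> int n * (int w * int n)"
    using n_pos mult_right_mono[of 1 "int n" "int w * int n"] by simp
  finally show "int (need i) * int n \<le> int n * (int n * int w)" by (simp add: ac_simps)
qed simp

lemma dead_key_bound: "- (int n * (int n * int w) + int n) \<le> dead_key" "dead_key \<le> 0"
proof -
  have "(1 + (\<Sum>i<n. int (need i))) * int n \<le> (1 + int n * int w) * int n"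
    using sum_need_le[of n] by (intro mult_right_mono) auto
  then show "- (int n * (int n * int w) + int n) \<le> dead_key"
    by (simp add: dead_key_def algebra_simps)
  have "0 \<le> (1 + (\<Sum>i<n. int (need i))) * int n" by (simp add: sum_nonneg)
  then show "dead_key \<le> 0" by (simp add: dead_key_def algebra_simps)
qed

text \<open>Each need is at most the sum of all needs; the additional -1 in \<open>dead_key\<close>
  makes the inequality strict.\<close>

lemma dead_key_less: "i < n \<Longrightarrow> dead_key < key i"
proof -
  assume i: "i < n"
  have "int (need i) \<le> (\<Sum>i<n. int (need i))"
    using i by (intro member_le_sum) auto
  then have "(- 1 - (\<Sum>i<n. int (need i))) * int n \<le> (- 1 - int (need i)) * int n"
    by (intro mult_right_mono) auto
  also have "\<dots> = - int (need i) * int n - int n" by (simp add: algebra_simps)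
  finally show ?thesis using n_pos unfolding dead_key_def key_def by linarith
qed

text \<open>Different needs shift keys by at least \<open>n\<close>, which the index parts, being
  below \<open>n\<close>, cannot compensate.\<close>

lemma need_le_if_key_le:
  assumes "i < n" "j < n" "key i \<le> key j"
  shows "need j \<le> need i"
proof (rule ccontr)
  assume "\<not> need j \<le> need i"
  then have "(int (need i) + 1) * int n \<le> int (need j) * int n"
    by (intro mult_right_mono) auto
  with assms show False by (simp add: key_def algebra_simps)
qed


section \<open>The tournament tree\<close>

definition base_regs :: "(nat \<Rightarrow> int) \<Rightarrow> bool" where
  "base_regs R \<longleftrightarrow> R rN = int n \<and> R rN2 = 2 * int n \<and> R rN3 = 3 * int n \<and> R rOne = 1 \<and> R rTwo = 2 \<and>
     R rNeg = - 1 \<and> R rNP = int n - 1 \<and> R rZero = 0"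

definition leaves_inv :: "nat \<Rightarrow> (nat \<Rightarrow> int) \<Rightarrow> (nat \<Rightarrow> int) \<Rightarrow> bool" where
  "leaves_inv i R M \<longleftrightarrow> base_regs R \<and> R rIdx = int i \<and> R rCur = 0 \<and> R rPos = 0 \<and>
     R rDead = - 1 - (\<Sum>k<i. int (need k)) \<and>
     (\<forall>k<n. M (2 * k) = int (p k) \<and> M (2 * k + 1) = int (q k)) \<and>
     (\<forall>k<i. M (3 * n + k) = key k)"

lemma leaves_init:
  "runs build_prog 8 (0, input n p q) (\<lambda>(pc, R, M). pc = 8 \<and> leaves_inv 0 R M)"
proof (rule reachI[of _ _ _ 8])
  show "wp B S build_prog 8 (0, input n p q) (\<lambda>(pc, R, M). pc = 8 \<and> leaves_inv 0 R M)"
    using n_pos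
    by (simp add: input_def build_prog_def leaves_inv_def base_regs_def
          del: of_nat_less_numeral_power_cancel_iff)
       (intro conjI; use word_bound in linarith)
qed simp

lemma leaves_step:
  assumes "leaves_inv i R M" "i < n"
  shows "wp B S build_prog 12 (8, R, M)
    (\<lambda>(pc, R, M). pc = (if Suc i < n then 8 else 20) \<and> leaves_inv (Suc i) R M)"
proof -
  have *: "0 \<le> (\<Sum>k<i. int (need k))" "(\<Sum>k<i. int (need k)) + int (need i) \<le> int n * int w"
    using sum_need_le[of "Suc i"] assms(2) by (simp_all add: sum_nonneg)
  show ?thesis
    using assms floor_log_rate[of i] rate[of i] rate_bound[of i]
    by (simp add: build_prog_def leaves_inv_def base_regs_def less_Suc_eq imp_disjL all_conj_distrib
          del: of_nat_less_numeral_power_cancel_iff)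
       (intro conjI; ((use assms(2) word_bound need_bound(1)[OF assms(2)] need_bound(2)[of i] *
          in linarith) | simp add: key_def))
qed

lemma leaves_loop:
  assumes "leaves_inv 0 R M"
  shows "runs build_prog (12 * n) (8, R, M) (\<lambda>(pc, R, M). pc = 20 \<and> leaves_inv n R M)"
proof -
  let ?I = "\<lambda>i (pc, R, M). pc = (if i < n then 8 else 20) \<and> leaves_inv i R M"
  have "runs build_prog (12 * (n - 0)) (8, R, M) (?I n)"
  proof (rule reach_iterate[of n ?I])
    fix i and c :: config assume i: "i < n" and c: "?I i c"
    then obtain R' M' where "c = (8, R', M')" "leaves_inv i R' M'" by (cases c) auto
    then show "runs build_prog 12 c (?I (Suc i))"
      using reachI[OF leaves_step[of i R' M'] order_refl] i by simp
  qed (use assms n_pos in auto)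
  then show ?thesis by simp
qed

section \<open>Building the tree bottom-up\<close>

definition leaf_keys :: "nat set \<Rightarrow> (nat \<Rightarrow> int) \<Rightarrow> bool" where
  "leaf_keys U M \<longleftrightarrow> (\<forall>i<n. M (3 * n + i) = (if i \<in> U then dead_key else key i))"

text \<open>The children of node \<open>v\<close> are \<open>2 * v\<close> and
  \<open>2 * v + 1\<close>; summands appear in the order in which the code adds them.\<close>

definition pulled :: "(nat \<Rightarrow> int) \<Rightarrow> nat \<Rightarrow> bool" where
  "pulled M v \<longleftrightarrow> M (2 * n + v) = max (M (2 * v + 2 * n)) (M (Suc (2 * v + 2 * n)))"

definition tree_inv :: "nat \<Rightarrow> (nat \<Rightarrow> int) \<Rightarrow> (nat \<Rightarrow> int) \<Rightarrow> bool" where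
  "tree_inv v R M \<longleftrightarrow> base_regs R \<and> R rNode = int v \<and> R rCur = 0 \<and> R rPos = 0 \<and>
     R rDead = dead_key \<and> leaf_keys {} M \<and> (\<forall>u>v. u < n \<longrightarrow> pulled M u)"

lemma pulled_update_same:
  "0 < v \<Longrightarrow> x = max (M (2 * v + 2 * n)) (M (Suc (2 * v + 2 * n))) \<Longrightarrow> pulled (M(2 * n + v := x)) v"
  by (simp add: pulled_def)

text \<open>A write to node \<open>v\<close> concerns only \<open>v\<close> itself and its
  parent.\<close>

lemma pulled_update_other:
  "u \<noteq> v \<Longrightarrow> u \<noteq> v div 2 \<Longrightarrow> pulled (M(2 * n + v := x)) u \<longleftrightarrow> pulled M u"
  by (auto simp: pulled_def)

lemma leaf_keys_update: "a < 3 * n \<Longrightarrow> leaf_keys U (M(a := x)) \<longleftrightarrow> leaf_keys U M"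
  by (auto simp: leaf_keys_def)

lemma tree_init:
  assumes "leaves_inv n R M"
  shows "wp B S build_prog 2 (20, R, M) (\<lambda>(pc, R, M). pc = 22 \<and> tree_inv (n - 1) R M)"
  using assms
  by (simp add: build_prog_def leaves_inv_def tree_inv_def base_regs_def leaf_keys_def dead_key_def)
     (use n_pos in \<open>intro conjI allI impI; use word_bound dead_key_bound[unfolded dead_key_def] in linarith\<close>)

lemma tree_pull:
  assumes "\<forall>u>v. u < n \<longrightarrow> pulled M u" "0 < v" "v - Suc 0 < u" "u < n"
    "x = max (M (2 * v + 2 * n)) (M (Suc (2 * v + 2 * n)))"
  shows "pulled (M(2 * n + v := x)) u"
  using assms by (cases "u = v") (auto simp: pulled_update_same pulled_update_other)

lemma tree_step:
  assumes "tree_inv v R M" "0 < v" "v < n"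
  shows "runs build_prog 12 (22, R, M) (\<lambda>(pc, R, M). pc = 22 \<and> tree_inv (v - 1) R M)"
\<comment> \<open>\<open>wp\<close> counts steps exactly, so the branches of 11 and 12 instructions
  are executed separately.\<close>
proof (cases "M (Suc (2 * v + 2 * n)) < M (2 * v + 2 * n)")
  case True
  have "wp B S build_prog 11 (22, R, M) (\<lambda>(pc, R, M). pc = 22 \<and> tree_inv (v - 1) R M)"
    using assms True
    by (simp add: build_prog_def tree_inv_def base_regs_def leaf_keys_update)
       (intro conjI allI impI; ((use assms word_bound in linarith) | (rule tree_pull, simp_all)))
  then show ?thesis by (rule reachI) simp
next
  case False
  have "wp B S build_prog 12 (22, R, M) (\<lambda>(pc, R, M). pc = 22 \<and> tree_inv (v - 1) R M)"
    using assms False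
    by (simp add: build_prog_def tree_inv_def base_regs_def leaf_keys_update)
       (intro conjI allI impI; ((use assms word_bound in linarith) | (rule tree_pull, simp_all)))
  then show ?thesis by (rule reachI) simp
qed

lemma tree_loop:
  assumes "tree_inv (n - 1) R M"
  shows "runs build_prog (12 * n) (22, R, M) (\<lambda>(pc, R, M). pc = 22 \<and> tree_inv 0 R M)"
proof -
  let ?I = "\<lambda>i (pc, R, M). pc = 22 \<and> tree_inv (n - 1 - i) R M"
  have "runs build_prog (12 * (n - 1 - 0)) (22, R, M) (?I (n - 1))"
  proof (rule reach_iterate[of "n - 1" ?I])
    fix i and c :: config assume i: "i < n - 1" and c: "?I i c"
    obtain R' M' where "c = (22, R', M')" "tree_inv (n - 1 - i) R' M'" using c by (cases c) auto
    then show "runs build_prog 12 c (?I (Suc i))"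
      using tree_step[of "n - 1 - i" R' M'] i by simp
  qed (use assms in auto)
  then show ?thesis by (rule reach_mono) auto
qed

section \<open>Extraction: invariant and root of the tree\<close>

definition pop_regs :: "nat \<Rightarrow> nat \<Rightarrow> (nat \<Rightarrow> int) \<Rightarrow> bool" where
  "pop_regs j e R \<longleftrightarrow> base_regs R \<and> R rIdx = int j \<and> R rCur = int e \<and> R rScale = 2 ^ e \<and>
     R rPos = 0 \<and> R rDead = dead_key"

definition tables ::
  "nat \<Rightarrow> (nat \<Rightarrow> nat) \<Rightarrow> (nat \<Rightarrow> nat) \<Rightarrow> (nat \<Rightarrow> int) \<Rightarrow> bool" where
  "tables j g k M \<longleftrightarrow> (\<forall>i<j. M i = int (g i) \<and> M (n + i) = 2 ^ k i)"

definition is_tree :: "(nat \<Rightarrow> int) \<Rightarrow> bool" where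
  "is_tree M \<longleftrightarrow> (\<forall>u. 0 < u \<longrightarrow> u < n \<longrightarrow> pulled M u)"

text \<open>\<open>g\<close> is the extraction order so far and \<open>k\<close> the exponents
  chosen. The last conjunct ensures that the current exponent does not exceed the need of whichever
  bamboo comes next.\<close>

definition pop_inv ::
  "nat \<Rightarrow> (nat \<Rightarrow> nat) \<Rightarrow> (nat \<Rightarrow> nat)
   \<Rightarrow> (nat \<Rightarrow> int) \<Rightarrow> (nat \<Rightarrow> int) \<Rightarrow> bool" where
  "pop_inv j g k R M \<longleftrightarrow> pop_regs j (prev k j) R \<and> tables j g k M \<and> inj_on g {..<j} \<and>
     g ` {..<j} \<subseteq> {..<n} \<and> leaf_keys (g ` {..<j}) M \<and> is_tree M \<and> capped n (need \<circ> g) k j \<and>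
     (\<forall>i<n. i \<notin> g ` {..<j} \<longrightarrow> prev k j \<le> need i)"

lemma pop_init:
  assumes "tree_inv 0 R M"
  shows "wp B S build_prog 3 (22, R, M) (\<lambda>(pc, R, M). pc = 36 \<and> pop_inv 0 (\<lambda>_. 0) (\<lambda>_. 0) R M)"
  using assms word_bound(1)
  by (simp add: build_prog_def tree_inv_def base_regs_def pop_inv_def pop_regs_def tables_def
      is_tree_def capped_def)
     (use word_bound in linarith)

text \<open>Moving to the parent \<open>v div 2\<close> never decreases the value. For
  \<open>n = 1\<close> the root is itself the leaf.\<close>

lemma tree_node_le_root:
  assumes "is_tree M" "0 < v" "v < 2 * n"
  shows "M (2 * n + v) \<le> M (2 * n + 1)"
  using assms(2,3)
proof (induction v rule: less_induct)
  case (less v)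
  show ?case
  proof (cases "v = 1")
    case False
    define u where "u = v div 2"
    have u: "0 < u" "u < v" "u < n" "v = 2 * u \<or> v = 2 * u + 1" using less.prems False by (auto simp: u_def)
    then have "M (2 * n + v) \<le> M (2 * n + u)"
      using assms(1) by (auto simp: is_tree_def pulled_def ac_simps)
    also have "\<dots> \<le> M (2 * n + 1)" using less.IH[of u] u by simp
    finally show ?thesis .
  qed simp
qed

text \<open>Descend to a child attaining the maximum; node numbers grow until a leaf is
  reached.\<close>

lemma tree_node_leaf:
  assumes "is_tree M" "0 < v" "v < 2 * n"
  shows "\<exists>i<n. M (2 * n + v) = M (3 * n + i)"
  using assms(2,3)
proof (induction "2 * n - v" arbitrary: v rule: less_induct)
  case less
  show ?case
  proof (cases "v < n")
    case True
    then have "pulled M v" using assms(1) less.prems by (simp add: is_tree_def)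
    then have "M (2 * n + v) = M (2 * n + 2 * v) \<or> M (2 * n + v) = M (2 * n + (2 * v + 1))"
      by (simp add: pulled_def max_def add.commute)
    then obtain u where u: "u = 2 * v \<or> u = 2 * v + 1" "M (2 * n + v) = M (2 * n + u)"
      by blast
    show ?thesis using less.hyps[of u] u True less.prems by auto
  next
    case False
    then show ?thesis using less.prems by (intro exI[of _ "v - n"]) auto
  qed
qed

text \<open>Live keys exceed \<open>dead_key\<close>, so while some leaf is live the root shows the
  largest live key, which belongs to a bamboo of least need.\<close>

lemma tree_root:
  assumes "is_tree M" "leaf_keys U M" "U \<subset> {..<n}"
  obtains b where "b < n" "b \<notin> U" "M (2 * n + 1) = key b" "\<And>i. i < n \<Longrightarrow> i \<notin> U \<Longrightarrow> need b \<le> need i"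
proof -
  obtain b where b: "b < n" "M (2 * n + 1) = M (3 * n + b)"
    using tree_node_leaf[OF assms(1), of 1] n_pos by auto
  have max: "M (3 * n + i) \<le> M (3 * n + b)" if "i < n" for i
    using tree_node_le_root[OF assms(1), of "n + i"] that b(2) by (simp add: ac_simps)
  obtain i where "i < n" "i \<notin> U" using assms(3) by auto
  with max[of i] assms(2) b(1) dead_key_less[of i] have bU: "b \<notin> U"
    by (auto simp: leaf_keys_def)
  have "need b \<le> need i" if "i < n" "i \<notin> U" for i
    using max[OF that(1)] assms(2) that b(1) bU by (intro need_le_if_key_le) (auto simp: leaf_keys_def)
  with that b bU assms(2) show thesis by (auto simp: leaf_keys_def)
qed

section \<open>Repairing the tree along the path to the root\<close>

lemma tables_update: "j \<le> n \<Longrightarrow> 2 * n \<le> a \<Longrightarrow> tables j g k (M(a := x)) \<longleftrightarrow> tables j g k M"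
  by (auto simp: tables_def)

lemma climb_pull:
  assumes "\<forall>u. 0 < u \<longrightarrow> u < n \<longrightarrow> u \<noteq> v \<longrightarrow> pulled M u" "0 < v" "0 < u" "u < n" "u \<noteq> v div 2"
    "x = max (M (2 * v + 2 * n)) (M (Suc (2 * v + 2 * n)))"
  shows "pulled (M(2 * n + v := x)) u"
  using assms by (cases "u = v") (auto simp: pulled_update_same pulled_update_other)

text \<open>\<open>v\<close> is the node written last, so only its parent may violate
  \<open>pulled\<close>.\<close>

definition climb_inv ::
  "nat \<Rightarrow> nat \<Rightarrow> (nat \<Rightarrow> nat) \<Rightarrow> (nat \<Rightarrow> nat) \<Rightarrow> nat set \<Rightarrow> nat \<Rightarrow> nat
   \<Rightarrow> (nat \<Rightarrow> int) \<Rightarrow> (nat \<Rightarrow> int) \<Rightarrow> bool" where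
  "climb_inv j e g k U m v R M \<longleftrightarrow> pop_regs j e R \<and> tables m g k M \<and> leaf_keys U M \<and> R rNode = int v \<and>
     (\<forall>u. 0 < u \<longrightarrow> u < n \<longrightarrow> u \<noteq> v div 2 \<longrightarrow> pulled M u)"

lemma climb_step:
  assumes "climb_inv j e g k U m v R M" "m \<le> n" "2 \<le> v" "v < 2 * n"
  shows "runs build_prog 12 (55, R, M) (\<lambda>(pc, R, M). pc = 55 \<and> climb_inv j e g k U m (v div 2) R M)"
proof -
  define u where "u = v div 2"
  have u: "0 < u" "u < n" "int v div 2 = int u" "v div 2 = u"
    using assms(3,4) by (auto simp: u_def zdiv_int)
  show ?thesis
  proof (cases "M (Suc (2 * u + 2 * n)) < M (2 * u + 2 * n)")
    case True
    have "wp B S build_prog 11 (55, R, M) (\<lambda>(pc, R, M). pc = 55 \<and> climb_inv j e g k U m u R M)"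
      using assms(1,2) True u
      by (simp add: build_prog_def climb_inv_def pop_regs_def base_regs_def leaf_keys_update tables_update
          del: of_nat_less_numeral_power_cancel_iff)
         (intro conjI allI impI; ((use u word_bound in linarith) | (rule climb_pull, simp_all)))
    then show ?thesis unfolding u by (rule reachI) simp
  next
    case False
    have "wp B S build_prog 12 (55, R, M) (\<lambda>(pc, R, M). pc = 55 \<and> climb_inv j e g k U m u R M)"
      using assms(1,2) False u
      by (simp add: build_prog_def climb_inv_def pop_regs_def base_regs_def leaf_keys_update tables_update
          del: of_nat_less_numeral_power_cancel_iff)
         (intro conjI allI impI; ((use u word_bound in linarith) | (rule climb_pull, simp_all)))
    then show ?thesis unfolding u by (rule reachI) simp
  qed
qed

text \<open>At the root \<open>v div 2\<close> is 0, so no internal node is exempt from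
  \<open>pulled\<close> any more.\<close>

lemma climb_exit:
  assumes "climb_inv j e g k U m v R M" "v < 2"
  shows "wp B S build_prog 2 (55, R, M)
    (\<lambda>(pc, R, M). pc = 67 \<and> pop_regs j e R \<and> tables m g k M \<and> leaf_keys U M \<and> is_tree M)"
proof -
  have v: "int v div 2 = 0" using assms(2) by simp
  show ?thesis
    using assms v
    by (simp add: build_prog_def climb_inv_def pop_regs_def base_regs_def is_tree_def)
qed

lemma climb:
  assumes "climb_inv j e g k U m v R M" "m \<le> n" "v < 2 * n" "v < 2 ^ l"
  shows "runs build_prog (12 * l + 2) (55, R, M)
    (\<lambda>(pc, R, M). pc = 67 \<and> pop_regs j e R \<and> tables m g k M \<and> leaf_keys U M \<and> is_tree M)"
  using assms(1,3,4)
proof (induction l arbitrary: v R M)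
  case 0
  then show ?case by (intro reachI[OF climb_exit]) auto
next
  case (Suc l)
  show ?case
  proof (cases "v < 2")
    case True
    then show ?thesis by (intro reachI[OF climb_exit[OF Suc.prems(1)]]) auto
  next
    case False
    show ?thesis
    proof (rule reach_trans[OF climb_step[OF Suc.prems(1) assms(2)]])
      fix c :: config assume "(\<lambda>(pc, R, M). pc = 55 \<and> climb_inv j e g k U m (v div 2) R M) c"
      then obtain R' M' where "c = (55, R', M')" "climb_inv j e g k U m (v div 2) R' M'" by (cases c) auto
      then show "runs build_prog (12 * l + 2) c
        (\<lambda>(pc, R, M). pc = 67 \<and> pop_regs j e R \<and> tables m g k M \<and> leaf_keys U M \<and> is_tree M)"
        using Suc.IH[of "v div 2" R' M'] Suc.prems by auto
    qed (use False Suc.prems in auto)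
  qed
qed

section \<open>Raising the exponent\<close>

definition gap_inv ::
  "nat \<Rightarrow> nat \<Rightarrow> nat \<Rightarrow> nat \<Rightarrow> (nat \<Rightarrow> int) \<Rightarrow> bool" where
  "gap_inv j b e d R \<longleftrightarrow> pop_regs j (e + d) R \<and> R rLog = - int (need b) \<and> R rBam = int b \<and>
     R rGap = 2 ^ d \<and> e + d \<le> need b"

lemma power_word: "e \<le> w \<Longrightarrow> (2 :: int) ^ e < 2 ^ B"
  using w_pos by (intro power_strict_increasing) auto

lemma gap_exit_wide:
  assumes "gap_inv j b e d R" "n \<le> 2 ^ d"
  shows "wp B S build_prog 1 (43, R, M) (\<lambda>(pc, R', M'). pc = 50 \<and> M' = M \<and> gap_inv j b e d R')"
proof -
  have "int n \<le> int (2 ^ d)" using assms(2) by (simp only: of_nat_le_iff)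
  then have "int n - 1 < 2 ^ d" unfolding of_nat_power of_nat_numeral by linarith
  with assms(1) show ?thesis
    by (simp add: build_prog_def gap_inv_def pop_regs_def base_regs_def)
qed

lemma gap_exit_full:
  assumes "gap_inv j b e d R" "2 ^ d < n" "e + d = need b"
  shows "wp B S build_prog 3 (43, R, M) (\<lambda>(pc, R', M'). pc = 50 \<and> M' = M \<and> gap_inv j b e d R')"
proof -
  have "int (2 ^ d) < int n" using assms(2) by (simp only: of_nat_less_iff)
  then have "\<not> int n - 1 < 2 ^ d" unfolding of_nat_power of_nat_numeral by linarith
  moreover have "int e + int d - int (need b) = 0" using assms(3) by simp
  ultimately show ?thesis using assms(1)
    by (simp add: build_prog_def gap_inv_def pop_regs_def base_regs_def)
qed

lemma gap_step:
  assumes "gap_inv j b e d R" "b < n" "2 ^ d < n" "e + d < need b"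
  shows "wp B S build_prog 7 (43, R, M) (\<lambda>(pc, R', M'). pc = 43 \<and> M' = M \<and> gap_inv j b e (Suc d) R')"
proof -
  have "int (2 ^ d) < int n" using assms(2,3) by (simp only: of_nat_less_iff)
  then have gap: "2 ^ d < int n" "\<not> int n - 1 < 2 ^ d"
    unfolding of_nat_power of_nat_numeral by linarith+
  have le: "int e + int d - int (need b) \<le> - 1" using assms(4) by simp
  then have neg: "\<not> - 1 < int e + int d - int (need b)" by simp
  have "2 ^ Suc (e + d) < (2 :: int) ^ B"
    using need_le[OF assms(2)] assms(4) by (intro power_word) simp
  then have "2 * (2 ^ (e + d)) < (2 :: int) ^ B" by simp
  with assms(1,4) gap neg show ?thesis
    by (simp add: build_prog_def gap_inv_def pop_regs_def base_regs_def)
       (intro conjI; (use need_le[OF assms(2)] need_bound(1)[OF assms(2)] word_bound gap le in linarith))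
qed

text \<open>The loop stops as soon as \<open>2 ^ d\<close> reaches \<open>n\<close>, so
  \<open>l\<close> bounds the number of doublings however large the need is.\<close>

lemma gap_loop:
  assumes "gap_inv j b e d R" "b < n" "n < 2 ^ (d + l)"
  shows "runs build_prog (7 * l + 3) (43, R, M) (\<lambda>(pc, R', M'). pc = 50 \<and> M' = M \<and>
     (\<exists>d. gap_inv j b e d R' \<and> (e + d = need b \<or> n \<le> 2 ^ d)))"
    (is "runs _ _ _ ?Q")
  using assms(1,3)
proof (induction l arbitrary: d R)
  case 0
  then show ?case
    by (intro reach_mono[OF reachI[OF gap_exit_wide order_refl]]) auto
next
  case (Suc l)
  consider "n \<le> 2 ^ d" | "2 ^ d < n" "e + d = need b" | "2 ^ d < n" "e + d < need b"
    using Suc.prems(1) by (auto simp: gap_inv_def) linarith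
  then show ?case
  proof cases
    case 1
    with Suc.prems show ?thesis
      by (intro reach_mono[OF reachI[OF gap_exit_wide order_refl]]) auto
  next
    case 2
    with Suc.prems show ?thesis
      by (intro reach_mono[OF reachI[OF gap_exit_full order_refl]]) auto
  next
    case 3
    show ?thesis
    proof (rule reach_trans[OF reachI[OF gap_step[OF Suc.prems(1) assms(2) 3] order_refl]])
      fix c :: config assume "(\<lambda>(pc, R', M'). pc = 43 \<and> M' = M \<and> gap_inv j b e (Suc d) R') c"
      then obtain R' where "c = (43, R', M)" "gap_inv j b e (Suc d) R'" by (cases c) auto
      then show "runs build_prog (7 * l + 3) c ?Q"
        using Suc.IH[of "Suc d" R'] Suc.prems(2) by simp
    qed simp
  qed
qed

section \<open>One complete extraction\<close>

lemma pop_select: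
  assumes "pop_inv j g k R M" "j < n"
  shows "\<exists>b<n. b \<notin> g ` {..<j} \<and> (\<forall>i<n. i \<notin> g ` {..<j} \<longrightarrow> need b \<le> need i) \<and>
    wp B S build_prog 7 (36, R, M) (\<lambda>(pc, R', M'). pc = 43 \<and> M' = M(j := int b) \<and>
     gap_inv j b (prev k j) 0 R')"
proof -
  have "g ` {..<j} \<noteq> {..<n}"
    using card_image_le[of "{..<j}" g] assms(2) by auto
  then obtain b where b: "b < n" "b \<notin> g ` {..<j}" "M (2 * n + 1) = key b"
      "\<And>i. i < n \<Longrightarrow> i \<notin> g ` {..<j} \<Longrightarrow> need b \<le> need i"
    using tree_root[of M "g ` {..<j}"] assms(1) unfolding pop_inv_def by blast
  \<comment> \<open>Division rounds down, so even for these nonpositive multiples of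
    \<open>n\<close> the index \<open>b < n\<close> is the remainder.\<close>
  have div: "key b div int n = - int (need b)"
    using div_mult_self1[of "int n" "int b" "- int (need b)"] b(1) by (simp add: key_def add.commute)
  have key: "key b + int (need b) * int n = int b" by (simp add: key_def)
  have pr: "prev k j \<le> need b" using assms(1) b by (simp add: pop_inv_def)
  have "wp B S build_prog 7 (36, R, M) (\<lambda>(pc, R', M'). pc = 43 \<and> M' = M(j := int b) \<and>
     gap_inv j b (prev k j) 0 R')"
    using assms b(1,3) div pr key n_pos
    by (simp add: build_prog_def pop_inv_def gap_inv_def pop_regs_def base_regs_def
        del: of_nat_less_numeral_power_cancel_iff)
       (intro conjI; (use word_bound b(1) need_le[OF b(1)] need_bound(1)[OF b(1)]
         need_bound(2)[of b] in linarith))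
  with b show ?thesis by blast
qed

lemma tables_Suc:
  "tables j g k M \<Longrightarrow> j < n \<Longrightarrow> tables (Suc j) (g(j := b)) (k(j := e)) (M(j := int b, n + j := 2 ^ e))"
  by (auto simp: tables_def less_Suc_eq)

lemma pulled_update_low: "0 < u \<Longrightarrow> a < 2 * n \<Longrightarrow> pulled (M(a := x)) u \<longleftrightarrow> pulled M u"
  by (auto simp: pulled_def)

lemma pop_store:
  assumes "pop_regs j e R" "R rBam = int b" "b < n" "j < n" "tables j g k M" "is_tree M" "leaf_keys U M"
  shows "wp B S build_prog 5 (50, R, M(j := int b)) (\<lambda>(pc, R, M). pc = 55 \<and>
    climb_inv j e (g(j := b)) (k(j := e)) (insert b U) (Suc j) (n + b) R M)"
proof -
  let ?M = "M(j := int b, n + j := 2 ^ e, 3 * n + b := dead_key)"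
  have "tables (Suc j) (g(j := b)) (k(j := e)) ?M"
    using tables_Suc[OF assms(5,4), of b e] assms(4) by (simp add: tables_update)
  moreover have "leaf_keys (insert b U) ?M"
    using assms(4,7) by (auto simp: leaf_keys_def)
  moreover have "pulled ?M u" if "0 < u" "u < n" "u \<noteq> (n + b) div 2" for u
    using pulled_update_other[of u "n + b" "M(j := int b, n + j := 2 ^ e)" dead_key] that assms(4,6)
    by (simp add: is_tree_def pulled_update_low algebra_simps)
  ultimately show ?thesis
    using assms(1-4)
    by (simp add: build_prog_def climb_inv_def pop_regs_def base_regs_def)
       (intro conjI; (use word_bound assms(3,4) in linarith))
qed

lemma capped_Suc:
  assumes "capped m f k j" "prev k j \<le> e" "e \<le> f' j" "e = f' j \<or> m * 2 ^ prev k j \<le> 2 ^ e"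
    "\<And>i. i < j \<Longrightarrow> f' i = f i"
  shows "capped m f' (k(j := e)) (Suc j)"
proof -
  have "prev (k(j := e)) i = prev k i" if "i \<le> j" for i
    using that by (cases i) auto
  with assms show ?thesis by (auto simp: capped_def less_Suc_eq)
qed

text \<open>The cost is 7 for selecting, \<open>7 * l + 3\<close> for the exponent, 5 for storing,
  \<open>12 * (l + 1) + 2\<close> for climbing from a leaf numbered below
  \<open>2 ^ (l + 1)\<close>, and 2 for the loop.\<close>

lemma pop_step:
  assumes inv: "pop_inv j g k R M" and j: "j < n" and l: "n < 2 ^ l"
  shows "runs build_prog (19 * l + 31) (36, R, M) (\<lambda>(pc, R, M).
    pc = (if Suc j < n then 36 else 69) \<and> (\<exists>g k. pop_inv (Suc j) g k R M))"
proof -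
  obtain b where b: "b < n" "b \<notin> g ` {..<j}" "\<And>i. i < n \<Longrightarrow> i \<notin> g ` {..<j} \<Longrightarrow> need b \<le> need i"
    and select: "wp B S build_prog 7 (36, R, M) (\<lambda>(pc, R', M'). pc = 43 \<and> M' = M(j := int b) \<and>
      gap_inv j b (prev k j) 0 R')"
    using pop_select[OF inv j] by blast
  show ?thesis
  proof (rule reach_trans[OF reachI[OF select order_refl]])
    fix c :: config
    assume "(\<lambda>(pc, R', M'). pc = 43 \<and> M' = M(j := int b) \<and> gap_inv j b (prev k j) 0 R') c"
    then obtain R1 where c: "c = (43, R1, M(j := int b))" "gap_inv j b (prev k j) 0 R1"
      by (cases c) auto
    show "runs build_prog (19 * l + 24) c (\<lambda>(pc, R, M).
        pc = (if Suc j < n then 36 else 69) \<and> (\<exists>g k. pop_inv (Suc j) g k R M))"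
      unfolding c(1)
    proof (rule reach_trans[OF gap_loop[OF c(2) b(1)]])
      show "n < 2 ^ (0 + l)" using l by simp
      fix c' :: config
      assume "(\<lambda>(pc, R', M'). pc = 50 \<and> M' = M(j := int b) \<and>
        (\<exists>d. gap_inv j b (prev k j) d R' \<and> (prev k j + d = need b \<or> n \<le> 2 ^ d))) c'"
      then obtain R2 d where c': "c' = (50, R2, M(j := int b))" and
        d: "gap_inv j b (prev k j) d R2" "prev k j + d = need b \<or> n \<le> 2 ^ d"
        by (cases c') auto
      define e where "e = prev k j + d"
      let ?g = "g(j := b)" and ?k = "k(j := e)" and ?U = "insert b (g ` {..<j})"
      have U: "?g ` {..<Suc j} = ?U" by (auto simp: lessThan_Suc)
      have store: "wp B S build_prog 5 c' (\<lambda>(pc, R, M). pc = 55 \<and>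
          climb_inv j e ?g ?k ?U (Suc j) (n + b) R M)"
        unfolding c' using d(1) b(1) j inv
        by (intro pop_store) (auto simp: gap_inv_def e_def pop_inv_def)
      have "capped n (need \<circ> ?g) ?k (Suc j)"
      proof (rule capped_Suc)
        show "capped n (need \<circ> g) k j" using inv by (simp add: pop_inv_def)
        show "e = (need \<circ> ?g) j \<or> n * 2 ^ prev k j \<le> 2 ^ e"
          using d(2) by (auto simp: e_def power_add)
      qed (use d(1) in \<open>auto simp: e_def gap_inv_def\<close>)
      moreover have "e \<le> need b" using d(1) by (simp add: e_def gap_inv_def)
      moreover have "inj_on ?g {..<Suc j}" "?g ` {..<Suc j} \<subseteq> {..<n}"
        using inv b(1,2) by (auto simp: pop_inv_def lessThan_Suc inj_on_def)
      \<comment> \<open>\<open>e \<le> need b\<close> and the minimality of \<open>need b\<close>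
        keep \<open>e\<close> below all remaining needs.\<close>
      ultimately have new: "pop_inv (Suc j) ?g ?k R' M'"
        if "pop_regs (Suc j) e R'" "tables (Suc j) ?g ?k M'" "leaf_keys ?U M'" "is_tree M'" for R' M'
        using that b(3) unfolding pop_inv_def U by force
      show "runs build_prog (12 * l + 21) c' (\<lambda>(pc, R, M).
        pc = (if Suc j < n then 36 else 69) \<and> (\<exists>g k. pop_inv (Suc j) g k R M))"
      proof (rule reach_trans[OF reachI[OF store order_refl]])
        fix c2 :: config
        assume "(\<lambda>(pc, R, M). pc = 55 \<and> climb_inv j e ?g ?k ?U (Suc j) (n + b) R M) c2"
        then obtain R3 M3 where c2: "c2 = (55, R3, M3)" "climb_inv j e ?g ?k ?U (Suc j) (n + b) R3 M3"
          by (cases c2) auto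
        show "runs build_prog (12 * l + 16) c2 (\<lambda>(pc, R, M).
          pc = (if Suc j < n then 36 else 69) \<and> (\<exists>g k. pop_inv (Suc j) g k R M))"
          unfolding c2(1)
        proof (rule reach_trans[OF climb[OF c2(2)]])
          show "Suc j \<le> n" "n + b < 2 * n" "n + b < 2 ^ Suc l" using j b(1) l by simp_all
          fix c3 :: config
          assume "(\<lambda>(pc, R, M). pc = 67 \<and> pop_regs j e R \<and> tables (Suc j) ?g ?k M \<and>
            leaf_keys ?U M \<and> is_tree M) c3"
          then obtain R4 M4 where c3: "c3 = (67, R4, M4)" "pop_regs j e R4"
            "tables (Suc j) ?g ?k M4" "leaf_keys ?U M4" "is_tree M4" by (cases c3) auto
          have "wp B S build_prog 2 c3 (\<lambda>(pc, R, M). pc = (if Suc j < n then 36 else 69) \<and>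
              M = M4 \<and> pop_regs (Suc j) e R)"
            using c3(1,2) j
            by (simp add: build_prog_def pop_regs_def base_regs_def) (use j word_bound in linarith)
          then show "runs build_prog 2 c3 (\<lambda>(pc, R, M).
              pc = (if Suc j < n then 36 else 69) \<and> (\<exists>g k. pop_inv (Suc j) g k R M))"
            by (rule reach_mono[OF reachI[OF _ order_refl]]) (use new c3 in blast)+
        qed simp
      qed simp
    qed simp
  qed simp
qed


section \<open>Endpoints and queries\<close>

definition selection :: "(nat \<Rightarrow> nat) \<Rightarrow> (nat \<Rightarrow> nat) \<Rightarrow> bool" where
  "selection g k \<longleftrightarrow> inj_on g {..<n} \<and> g ` {..<n} \<subseteq> {..<n} \<and> capped n (need \<circ> g) k n"

lemma selection_bij: "selection g k \<Longrightarrow> bij_betw g {..<n} {..<n}"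
  by (simp add: selection_def bij_betw_def endo_inj_surj)

text \<open>Each \<open>2 ^ - need i\<close> is at most \<open>h i\<close>, so the required lengths
  sum to at most 1; \<open>kraft_capped\<close> transfers this to the capped ones.\<close>

lemma selection_kraft:
  assumes "selection g k"
  shows "(\<Sum>j<n. (1 / 2 :: real) ^ k j) \<le> 1"
proof (rule kraft_capped)
  show "capped n (need \<circ> g) k n" using assms by (simp add: selection_def)
  have "(\<Sum>j<n. (1 / 2 :: real) ^ (need \<circ> g) j) = (\<Sum>i<n. (1 / 2) ^ need i)"
    using sum.reindex_bij_betw[OF selection_bij[OF assms], of "\<lambda>i. (1 / 2 :: real) ^ need i"] by simp
  also have "\<dots> \<le> (\<Sum>i<n. h i)" by (intro sum_mono h_bounds) auto
  finally show "(\<Sum>j<n. (1 / 2 :: real) ^ (need \<circ> g) j) \<le> 1"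
    using inst by (simp add: bgt_instance_def)
qed

text \<open>\<open>prev k n\<close> is the last and hence largest exponent. It serves as the
  resolution of the endpoints and as the number of counter bits.\<close>

lemma selection_le:
  assumes "selection g k" "j < n"
  shows "k j \<le> need (g j)" "k j \<le> prev k n" "prev k n \<le> w"
proof -
  obtain m where m: "n = Suc m" using n_pos by (cases n) auto
  have need: "k j \<le> need (g j)" if "j < n" for j
    using assms(1) that by (auto simp: selection_def capped_def)
  from assms(2) show "k j \<le> need (g j)" by (rule need)
  show "k j \<le> prev k n"
    using capped_mono[of n "need \<circ> g" k n j m] assms unfolding selection_def by (simp add: m)
  have "g m < n" using assms(1) lessI[of m] unfolding selection_def m[symmetric] by blast
  with need[of m] need_le[of "g m"] m show "prev k n \<le> w" by simp
qed

lemma selection_start_le: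
  assumes "selection g k" "j \<le> n"
  shows "slot_start k (prev k n) j \<le> 2 ^ prev k n"
  using slot_start_le[OF selection_kraft[OF assms(1)] selection_le(2)[OF assms(1)]] assms(2) by simp

lemma pop_loop:
  assumes "pop_inv 0 g k R M" "n < 2 ^ l"
  shows "runs build_prog ((19 * l + 31) * n) (36, R, M)
    (\<lambda>(pc, R, M). pc = 69 \<and> (\<exists>g k. pop_inv n g k R M))"
proof -
  let ?I = "\<lambda>j (pc, R, M). pc = (if j < n then 36 else 69) \<and> (\<exists>g k. pop_inv j g k R M)"
  have "runs build_prog ((19 * l + 31) * (n - 0)) (36, R, M) (?I n)"
  proof (rule reach_iterate[of n ?I])
    fix j and c :: config assume j: "j < n" and c: "?I j c"
    then obtain R' M' g k where "c = (36, R', M')" "pop_inv j g k R' M'" by (cases c) auto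
    then show "runs build_prog (19 * l + 31) c (?I (Suc j))"
      using pop_step[of j g k R' M' l] j assms(2) by simp
  qed (use assms(1) n_pos in auto)
  then show ?thesis by simp
qed

section \<open>Turning lengths into left endpoints\<close>

definition starts_inv ::
  "nat \<Rightarrow> (nat \<Rightarrow> nat) \<Rightarrow> (nat \<Rightarrow> nat)
   \<Rightarrow> (nat \<Rightarrow> int) \<Rightarrow> (nat \<Rightarrow> int) \<Rightarrow> bool" where
  "starts_inv j g k R M \<longleftrightarrow> base_regs R \<and> R rIdx = int j \<and> R rScale = 2 ^ prev k n \<and>
     R rPos = int (slot_start k (prev k n) j) \<and> (\<forall>i<n. M i = int (g i)) \<and>
     (\<forall>i<n. M (n + i) = (if i < j then int (slot_start k (prev k n) i) else 2 ^ k i))"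

lemma starts_init:
  assumes "pop_inv n g k R M"
  shows "selection g k" "wp B S build_prog 1 (69, R, M) (\<lambda>(pc, R, M). pc = 70 \<and> starts_inv 0 g k R M)"
proof -
  show "selection g k" using assms by (simp add: pop_inv_def selection_def)
  show "wp B S build_prog 1 (69, R, M) (\<lambda>(pc, R, M). pc = 70 \<and> starts_inv 0 g k R M)"
    using assms
    by (simp add: build_prog_def pop_inv_def pop_regs_def base_regs_def starts_inv_def tables_def)
qed

lemma starts_step:
  assumes "selection g k" "starts_inv j g k R M" "j < n"
  shows "wp B S build_prog 7 (70, R, M)
    (\<lambda>(pc, R, M). pc = (if Suc j < n then 70 else 77) \<and> starts_inv (Suc j) g k R M)"
proof -
  let ?K = "prev k n"
  have div: "2 ^ ?K div 2 ^ k j = (2 :: int) ^ (?K - k j)"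
    using selection_le(2)[OF assms(1,3)] by (simp add: power_diff)
  have size: "(2 :: int) ^ (?K - k j) < 2 ^ B" and scale: "(2 :: int) ^ ?K < 2 ^ B"
    using selection_le(3)[OF assms(1,3)] by (intro power_word; simp)+
  \<comment> \<open>The Kraft inequality keeps the accumulated endpoint, including the new length,
    at most \<open>2 ^ ?K\<close>, so it fits in a word.\<close>
  have "int (slot_start k ?K (Suc j)) \<le> int (2 ^ ?K)"
    using selection_start_le[of g k "Suc j"] assms(1,3) by (simp only: of_nat_le_iff)
  also have "\<dots> = 2 ^ ?K" by simp
  also note scale
  finally have "int (slot_start k ?K j) + 2 ^ (?K - k j) < 2 ^ B" by (simp add: slot_start_Suc)
  with size assms(2,3) div show ?thesis
    by (simp add: build_prog_def starts_inv_def base_regs_def slot_start_Suc)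
       (use word_bound in linarith)
qed

lemma starts_loop:
  assumes "selection g k" "starts_inv 0 g k R M"
  shows "runs build_prog (7 * n) (70, R, M) (\<lambda>(pc, R, M). pc = 77 \<and> starts_inv n g k R M)"
proof -
  let ?I = "\<lambda>j (pc, R, M). pc = (if j < n then 70 else 77) \<and> starts_inv j g k R M"
  have "runs build_prog (7 * (n - 0)) (70, R, M) (?I n)"
  proof (rule reach_iterate[of n ?I])
    fix j and c :: config assume j: "j < n" and c: "?I j c"
    then obtain R' M' where "c = (70, R', M')" "starts_inv j g k R' M'" by (cases c) auto
    then show "runs build_prog 7 c (?I (Suc j))"
      using reachI[OF starts_step[of g k j R' M'] order_refl] j assms(1) by simp
  qed (use assms(2) n_pos in auto)
  then show ?thesis by simp
qed

text \<open>The day enters only through its last \<open>prev k n\<close> bits, so the state stays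
  bounded although \<open>D\<close> does not. \<open>rHalf\<close> is the top bit of the counter, or
  0 if the counter has no bits.\<close>

definition day_inv ::
  "nat \<Rightarrow> (nat \<Rightarrow> nat) \<Rightarrow> (nat \<Rightarrow> nat)
   \<Rightarrow> (nat \<Rightarrow> int) \<Rightarrow> (nat \<Rightarrow> int) \<Rightarrow> bool" where
  "day_inv D g k R M \<longleftrightarrow> base_regs R \<and> R rPos = int (bitrev (prev k n) D) \<and>
     R rHalf = 2 ^ prev k n div 2 \<and>
     (\<forall>i<n. M i = int (g i) \<and> M (n + i) = int (slot_start k (prev k n) i))"

lemma day_init:
  assumes "selection g k" "starts_inv n g k R M"
  shows "wp B S build_prog 2 (77, R, M) (\<lambda>(pc, R, M). pc = 79 \<and> day_inv 0 g k R M)"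
proof -
  let ?K = "prev k n"
  have "(2 :: int) ^ ?K < 2 ^ B"
    using selection_le(3)[OF assms(1) n_pos] by (rule power_word)
  moreover have "(2 :: int) ^ ?K div 2 \<le> 2 ^ ?K" "0 \<le> (2 :: int) ^ ?K div 2"
    using zero_le_power[of "2 :: int" ?K] by linarith+
  ultimately have "(2 :: int) ^ ?K div 2 < 2 ^ B" "0 \<le> (2 :: int) ^ ?K div 2" by linarith+
  with assms(2) show ?thesis
    by (simp add: build_prog_def starts_inv_def day_inv_def base_regs_def)
qed

lemma build_correct:
  assumes "n < 2 ^ l"
  shows "runs build_prog ((19 * l + 62) * n + 16) (0, input n p q)
    (\<lambda>(pc, R, M). pc = 79 \<and> (\<exists>g k. selection g k \<and> day_inv 0 g k R M))"
proof -
  have seq: "runs P u c Q'" if "runs P t c (\<lambda>(pc, R, M). pc = a \<and> I R M)"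
    "\<And>R M. I R M \<Longrightarrow> runs P t' (a, R, M) Q'" "t + t' \<le> u" for P u c Q' t a I t'
    using that(1) by (rule reach_trans) (use that in auto)
  show ?thesis
    apply (rule seq[OF leaves_init])
    apply (rule seq[OF leaves_loop], assumption)
    apply (rule seq[OF reachI[OF tree_init order_refl]], assumption)
    apply (rule seq[OF tree_loop], assumption)
    apply (rule seq[OF reachI[OF pop_init order_refl]], assumption)
    apply (rule seq[OF pop_loop], assumption, rule assms)
    apply (elim exE)
    apply (frule starts_init(1))
    apply (rule seq[OF reachI[OF starts_init(2) order_refl]], assumption)
    apply (rule seq[OF starts_loop], assumption, assumption)
    apply (rule reach_mono[OF reachI[OF day_init order_refl]])
    apply (assumption, assumption, force, rule order_refl)
    apply (rule order_refl | (simp add: algebra_simps))+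
    done
qed

section \<open>Binary search for the slot\<close>

definition search_inv ::
  "nat \<Rightarrow> (nat \<Rightarrow> nat) \<Rightarrow> (nat \<Rightarrow> nat) \<Rightarrow> nat \<Rightarrow> nat
   \<Rightarrow> (nat \<Rightarrow> int) \<Rightarrow> (nat \<Rightarrow> int) \<Rightarrow> bool" where
  "search_inv D g k a b R M \<longleftrightarrow> day_inv D g k R M \<and> R rLo = int a \<and> R rHi = int b \<and> a < b \<and> b \<le> n \<and>
     slot_start k (prev k n) a \<le> bitrev (prev k n) D \<and>
     (b < n \<longrightarrow> bitrev (prev k n) D < slot_start k (prev k n) b)"

lemma search_init:
  assumes "day_inv D g k R M"
  shows "wp B S query_prog 2 (0, R, M) (\<lambda>(pc, R', M'). pc = 2 \<and> M' = M \<and> search_inv D g k 0 n R' M)"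
  using assms n_pos
  by (simp add: query_prog_def search_inv_def day_inv_def base_regs_def
        del: of_nat_less_numeral_power_cancel_iff)
     (use word_bound in linarith)

lemma search_exit:
  assumes "search_inv D g k a b R M" "b < a + 2"
  shows "wp B S query_prog 2 (2, R, M) (\<lambda>(pc, R', M'). pc = 13 \<and> M' = M \<and> day_inv D g k R' M \<and>
    R' rLo = int (slot n k (prev k n) (bitrev (prev k n) D)))"
proof -
  have b: "b = Suc a" "a < n" using assms by (auto simp: search_inv_def)
  \<comment> \<open>For \<open>b = n\<close> there is no upper comparison, and
    \<open>slot_eqI\<close> asks for none at the last interval.\<close>
  then have "slot n k (prev k n) (bitrev (prev k n) D) = a"
    using assms(1) by (intro slot_eqI) (auto simp: search_inv_def)
  with assms(1) b show ?thesis
    by (simp add: query_prog_def search_inv_def day_inv_def base_regs_def)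
       (use word_bound b in linarith)
qed

text \<open>Both halves of the range have length at most \<open>r\<close>, and both branches take
  nine instructions.\<close>

lemma search_step:
  assumes "search_inv D g k a b R M" "a + 2 \<le> b" "b - a \<le> 2 * r"
  shows "wp B S query_prog 9 (2, R, M) (\<lambda>(pc, R', M'). pc = 2 \<and> M' = M \<and>
    (\<exists>a b. search_inv D g k a b R' M \<and> b - a \<le> r))"
proof -
  define m where "m = (a + b) div 2"
  have m: "(int a + int b) div 2 = int m" by (simp add: m_def zdiv_int)
  have ab: "b \<le> n" "a < m" "m < b" "m - a \<le> r" "b - m \<le> r"
    using assms by (auto simp: m_def search_inv_def)
  have nb: "\<not> int b - int a < 2" using assms(2) by simp
  show ?thesis
  proof (cases "bitrev (prev k n) D < slot_start k (prev k n) m")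
    case True
    have "wp B S query_prog 9 (2, R, M) (\<lambda>(pc, R', M'). pc = 2 \<and> M' = M \<and> search_inv D g k a m R' M)"
      using assms(1) ab True m nb
      by (simp add: query_prog_def search_inv_def day_inv_def base_regs_def
          del: of_nat_less_numeral_power_cancel_iff)
         (use word_bound ab in linarith)
    with ab show ?thesis unfolding wp_def by blast
  next
    case False
    have "wp B S query_prog 9 (2, R, M) (\<lambda>(pc, R', M'). pc = 2 \<and> M' = M \<and> search_inv D g k m b R' M)"
      using assms(1) ab False m nb
      by (simp add: query_prog_def search_inv_def day_inv_def base_regs_def
          del: of_nat_less_numeral_power_cancel_iff)
         (use word_bound ab in linarith)
    with ab show ?thesis unfolding wp_def by blast
  qed
qed

lemma search_loop:
  assumes "search_inv D g k a b R M" "b - a \<le> 2 ^ l"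
  shows "runs query_prog (9 * l + 2) (2, R, M) (\<lambda>(pc, R', M'). pc = 13 \<and> M' = M \<and> day_inv D g k R' M \<and>
    R' rLo = int (slot n k (prev k n) (bitrev (prev k n) D)))" (is "runs _ _ _ ?Q")
  using assms
proof (induction l arbitrary: a b R)
  case 0
  then show ?case by (intro reachI[OF search_exit]) auto
next
  case (Suc l)
  show ?case
  proof (cases "b < a + 2")
    case True
    then show ?thesis by (intro reachI[OF search_exit[OF Suc.prems(1)]]) auto
  next
    case False
    show ?thesis
    proof (rule reach_trans[OF reachI[OF search_step[OF Suc.prems(1)] order_refl]])
      fix c :: config
      assume "(\<lambda>(pc, R', M'). pc = 2 \<and> M' = M \<and> (\<exists>a b. search_inv D g k a b R' M \<and> b - a \<le> 2 ^ l)) c"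
      then obtain R' a b where "c = (2, R', M)" "search_inv D g k a b R' M" "b - a \<le> 2 ^ l"
        by (cases c) auto
      then show "runs query_prog (9 * l + 2) c ?Q" using Suc.IH by simp
    qed (use Suc.prems False in auto)
  qed
qed

text \<open>The lowest bit of \<open>E\<close> is the top bit of \<open>rPos\<close>. If it is 0,
  setting it finishes; if it is 1, clearing it leaves the same problem for \<open>E div 2\<close>
  with one bit fewer.\<close>

lemma carry_loop:
  assumes "base_regs R" "R rPos = int (bitrev k E)" "R rBit = 2 ^ k div 2" "k \<le> w"
  shows "runs query_prog (4 * carries k E + 5) (15, R, M) (\<lambda>(pc, R', M'). pc = 20 \<and> M' = M \<and>
    R' rPos = int (bitrev k (Suc E)) \<and> (\<forall>r. r \<noteq> rPos \<longrightarrow> r \<noteq> rBit \<longrightarrow> R' r = R r))"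
    (is "runs _ _ _ (?Q k E R)")
  using assms
proof (induction k arbitrary: E R)
  case 0
  then have "wp B S query_prog 5 (15, R, M) (?Q 0 E R)"
    by (simp add: query_prog_def base_regs_def)
  then show ?case by (rule reachI) simp
next
  case (Suc k)
  have word: "(2 :: int) ^ k < 2 ^ B" using Suc.prems(4) by (intro power_word) simp
  have rest: "int (bitrev k F) < 2 ^ k" for F
    using bitrev_less[of k F] by (metis of_nat_less_iff of_nat_numeral of_nat_power)
  show ?case
  proof (cases "even E")
    case True
    then have E: "bitrev (Suc k) E = bitrev k (E div 2)"
      "bitrev (Suc k) (Suc E) = 2 ^ k + bitrev k (E div 2)"
      by (auto simp: even_iff_mod_2_eq_zero)
    have "(2 :: int) ^ Suc k < 2 ^ B" using Suc.prems(4) by (rule power_word)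
    then have "int (bitrev k (E div 2)) + 2 ^ k < 2 ^ B"
      using rest[of "E div 2"] unfolding power_Suc by linarith
    then have "wp B S query_prog 2 (15, R, M) (?Q (Suc k) E R)"
      using Suc.prems(1-3) rest[of "E div 2"] unfolding E
      by (simp add: query_prog_def base_regs_def del: bitrev.simps)
    then show ?thesis by (rule reachI) simp
  next
    case False
    then have E: "bitrev (Suc k) E = 2 ^ k + bitrev k (E div 2)"
      "bitrev (Suc k) (Suc E) = bitrev k (Suc (E div 2))"
      "carries (Suc k) E = Suc (carries k (E div 2))"
      by (auto simp: odd_iff_mod_2_eq_one)
    show ?thesis
    \<comment> \<open>On the last bit \<open>rBit\<close> becomes 0 and control falls through
      instead of looping, so the induction hypothesis does not apply here.\<close>
    proof (cases "k = 0")
      case True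
      have "wp B S query_prog 5 (15, R, M) (?Q (Suc k) E R)"
        using Suc.prems(1-3) word unfolding E
        by (simp add: True query_prog_def base_regs_def del: bitrev.simps(2))
      then show ?thesis by (rule reachI) simp
    next
      case k: False
      then have half: "0 < (2 :: int) ^ k div 2" by (cases k) auto
      have bound: "(2 :: int) ^ k div 2 < 2 ^ B" using word half by linarith
      have "int (bitrev k (E div 2)) < 2 ^ B" using rest[of "E div 2"] word by linarith
      then have "wp B S query_prog 4 (15, R, M) (\<lambda>(pc, R', M'). pc = 15 \<and> M' = M \<and> base_regs R' \<and>
          R' rPos = int (bitrev k (E div 2)) \<and> R' rBit = 2 ^ k div 2 \<and>
          (\<forall>r. r \<noteq> rPos \<longrightarrow> r \<noteq> rBit \<longrightarrow> R' r = R r))"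
        using Suc.prems(1-3) half bound rest[of "E div 2"] unfolding E
        by (simp add: query_prog_def base_regs_def del: bitrev.simps of_nat_less_numeral_power_cancel_iff)
      then show ?thesis
      proof (rule reach_trans[OF reachI[OF _ order_refl]])
        fix c :: config
        assume "(\<lambda>(pc, R', M'). pc = 15 \<and> M' = M \<and> base_regs R' \<and>
          R' rPos = int (bitrev k (E div 2)) \<and> R' rBit = 2 ^ k div 2 \<and>
          (\<forall>r. r \<noteq> rPos \<longrightarrow> r \<noteq> rBit \<longrightarrow> R' r = R r)) c"
        then obtain R' where c: "c = (15, R', M)" "base_regs R'" "R' rPos = int (bitrev k (E div 2))"
          "R' rBit = 2 ^ k div 2" "\<forall>r. r \<noteq> rPos \<longrightarrow> r \<noteq> rBit \<longrightarrow> R' r = R r" by (cases c) auto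
        have "runs query_prog (4 * carries k (E div 2) + 5) c (?Q k (E div 2) R')"
          unfolding c(1) using Suc.IH[OF c(2-4)] Suc.prems(4) by simp
        then show "runs query_prog (4 * carries k (E div 2) + 5) c (?Q (Suc k) E R)"
          unfolding E(2) by (rule reach_mono) (use c(5) in auto)
      qed (unfold E(3), simp)
    qed
  qed
qed

lemma query_correct:
  assumes "selection g k" "day_inv D g k R M" "n < 2 ^ l"
  shows "runs query_prog (9 * l + 11 + 4 * carries (prev k n) D) (0, R, M) (\<lambda>(pc, R, M). pc = 20 \<and>
    day_inv (Suc D) g k R M \<and> R rOut = int (g (slot n k (prev k n) (bitrev (prev k n) D))))"
    (is "runs _ _ _ ?Q")
proof -
  let ?s = "slot n k (prev k n) (bitrev (prev k n) D)"
  have K: "prev k n \<le> w" using selection_le(3)[OF assms(1) n_pos] .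
  have s: "?s < n" using slot_less[OF n_pos] .
  have load: "wp B S query_prog 2 (13, R', M) (\<lambda>(pc, R', M'). pc = 15 \<and> M' = M \<and> day_inv D g k R' M \<and>
      R' rBit = 2 ^ prev k n div 2 \<and> R' rOut = int (g ?s))"
    if "day_inv D g k R' M" "R' rLo = int ?s" for R'
  proof -
    have "0 \<le> (2 :: int) ^ prev k n div 2" "(2 :: int) ^ prev k n div 2 \<le> 2 ^ prev k n"
      using zero_le_power[of "2 :: int" "prev k n"] by linarith+
    then have "0 \<le> (2 :: int) ^ prev k n div 2" "(2 :: int) ^ prev k n div 2 < 2 ^ B"
      using power_word[OF K] by linarith+
    with that s show ?thesis
      by (simp add: query_prog_def day_inv_def base_regs_def)
  qed
  have incr: "runs query_prog (5 + 4 * carries (prev k n) D) (15, R', M) ?Q"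
    if R': "day_inv D g k R' M" "R' rBit = 2 ^ prev k n div 2" "R' rOut = int (g ?s)" for R'
  proof (rule reach_mono[OF carry_loop[of R' "prev k n" D M]])
    show "base_regs R'" "R' rPos = int (bitrev (prev k n) D)" using R'(1) by (auto simp: day_inv_def)
    fix c :: config
    assume "(\<lambda>(pc, R'', M'). pc = 20 \<and> M' = M \<and> R'' rPos = int (bitrev (prev k n) (Suc D)) \<and>
      (\<forall>r. r \<noteq> rPos \<longrightarrow> r \<noteq> rBit \<longrightarrow> R'' r = R' r)) c"
    with R'(1,3) show "?Q c"
      by (cases c) (simp add: day_inv_def base_regs_def del: bitrev.simps)
  qed (use R'(2) K in simp_all)
  show ?thesis
  proof (rule reach_trans[OF reachI[OF search_init[OF assms(2)] order_refl]])
    fix c :: config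
    assume "(\<lambda>(pc, R', M'). pc = 2 \<and> M' = M \<and> search_inv D g k 0 n R' M) c"
    then obtain R1 where c: "c = (2, R1, M)" "search_inv D g k 0 n R1 M" by (cases c) auto
    show "runs query_prog (9 * l + 9 + 4 * carries (prev k n) D) c ?Q"
      unfolding c(1)
    proof (rule reach_trans[OF search_loop[OF c(2), of l]])
      fix c1 :: config
      assume "(\<lambda>(pc, R', M'). pc = 13 \<and> M' = M \<and> day_inv D g k R' M \<and> R' rLo = int ?s) c1"
      then obtain R2 where c1: "c1 = (13, R2, M)" "day_inv D g k R2 M" "R2 rLo = int ?s"
        by (cases c1) auto
      show "runs query_prog (7 + 4 * carries (prev k n) D) c1 ?Q"
        unfolding c1(1)
      proof (rule reach_trans[OF reachI[OF load[OF c1(2,3)] order_refl]])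
        fix c2 :: config
        assume "(\<lambda>(pc, R', M'). pc = 15 \<and> M' = M \<and> day_inv D g k R' M \<and>
          R' rBit = 2 ^ prev k n div 2 \<and> R' rOut = int (g ?s)) c2"
        then show "runs query_prog (5 + 4 * carries (prev k n) D) c2 ?Q"
          using incr by (cases c2) auto
      qed simp
    qed (use assms(3) in simp_all)
  qed simp
qed

text \<open>The interval of bamboo \<open>i\<close> has exponent at most \<open>need i\<close>, so
  it is hit in any \<open>2 ^ need i\<close> consecutive days, and
  \<open>h i * 2 ^ need i \<le> 2\<close>.\<close>

lemma makespan_selection:
  assumes "selection g k"
  shows "makespan n h (\<lambda>D. Some (g (slot n k (prev k n) (bitrev (prev k n) D)))) \<le> 2"
proof -
  let ?s = "\<lambda>D. Some (g (slot n k (prev k n) (bitrev (prev k n) D)))"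
  have "makespan n h ?s \<le> ereal 2"
  proof (rule makespan_leI[where P = "\<lambda>i. 2 ^ need i"])
    fix i assume i: "i < n"
    then show "0 \<le> h i \<and> h i * real (2 ^ need i) \<le> 2"
      using h_pos[OF i] h_bounds(2)[OF i] by simp
    fix a
    obtain j where j: "j < n" "g j = i"
      using selection_bij[OF assms] i by (metis bij_betw_imp_surj_on imageE lessThan_iff)
    obtain D where D: "a \<le> D" "D < a + 2 ^ k j" "slot n k (prev k n) (bitrev (prev k n) D) = j"
      using slot_window[OF _ selection_kraft[OF assms] j(1) selection_le(2)[OF assms], of "need \<circ> g" a]
        assms by (auto simp: selection_def)
    have "(2 :: nat) ^ k j \<le> 2 ^ need i"
      using selection_le(1)[OF assms j(1)] j(2) by (intro power_increasing) auto
    with D(2) have "D < a + 2 ^ need i" by linarith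
    with D(1,3) j(2) show "\<exists>D\<ge>a. D < a + 2 ^ need i \<and> ?s D = Some i" by blast
  qed
  then show ?thesis by simp
qed

section \<open>The perpetual run and its total cost\<close>

lemma oracle_exists:
  assumes l: "n < 2 ^ l"
  shows "\<exists>T t ans. oracle_run B S build_prog query_prog (input n p q) T t ans \<and> (\<forall>D. ans D < n) \<and>
    makespan n h (\<lambda>D. Some (ans D)) \<le> 2 \<and> T \<le> (19 * l + 62) * n + 16 \<and>
    (\<forall>m. (\<Sum>D<m. t D) \<le> (9 * l + 15) * m)"
proof -
  obtain T \<sigma>0 where T: "T \<le> (19 * l + 62) * n + 16" "halts_in B S build_prog (input n p q) T \<sigma>0"
    and ex: "\<exists>g k. selection g k \<and> day_inv 0 g k (fst \<sigma>0) (snd \<sigma>0)"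
    using reach_halts[OF reach_mono[OF build_correct[OF l], of
          "\<lambda>(pc, s). length build_prog \<le> pc \<and> (\<exists>g k. selection g k \<and> day_inv 0 g k (fst s) (snd s))"]]
    by fastforce
  obtain g k where sel: "selection g k" and day0: "day_inv 0 g k (fst \<sigma>0) (snd \<sigma>0)"
    using ex by blast
  define ans where "ans D = g (slot n k (prev k n) (bitrev (prev k n) D))" for D
  define cost where "cost D = 9 * l + 11 + 4 * carries (prev k n) D" for D
  have query: "\<exists>t\<le>cost D. \<exists>s'. halts_in B S query_prog s t s' \<and>
      day_inv (Suc D) g k (fst s') (snd s') \<and> fst s' rOut = int (ans D)"
    if "day_inv D g k (fst s) (snd s)" for s D
    using reach_halts[OF reach_mono[OF query_correct[OF sel that l], of
          "\<lambda>(pc, s). length query_prog \<le> pc \<and> day_inv (Suc D) g k (fst s) (snd s) \<and> fst s rOut = int (ans D)"]]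
    by (fastforce simp: cost_def ans_def)
  \<comment> \<open>Dependent choice strings the queries together; the condition at
    \<open>D = 0\<close> ties the sequence to the state left by building.\<close>
  have "\<exists>\<sigma>. \<forall>D. (day_inv D g k (fst (\<sigma> D)) (snd (\<sigma> D)) \<and> (D = 0 \<longrightarrow> \<sigma> D = \<sigma>0)) \<and>
      (\<exists>t\<le>cost D. halts_in B S query_prog (\<sigma> D) t (\<sigma> (Suc D)) \<and> fst (\<sigma> (Suc D)) rOut = int (ans D))"
  proof (rule dependent_nat_choice)
    show "\<exists>s. day_inv 0 g k (fst s) (snd s) \<and> ((0 :: nat) = 0 \<longrightarrow> s = \<sigma>0)" using day0 by blast
    fix s D assume "day_inv D g k (fst s) (snd s) \<and> (D = 0 \<longrightarrow> s = \<sigma>0)"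
    then show "\<exists>s'. (day_inv (Suc D) g k (fst s') (snd s') \<and> (Suc D = 0 \<longrightarrow> s' = \<sigma>0)) \<and>
        (\<exists>t\<le>cost D. halts_in B S query_prog s t s' \<and> fst s' rOut = int (ans D))"
      using query[of D s] by blast
  qed
  then obtain \<sigma> where \<sigma>: "\<sigma> 0 = \<sigma>0"
    "\<And>D. \<exists>t\<le>cost D. halts_in B S query_prog (\<sigma> D) t (\<sigma> (Suc D)) \<and> fst (\<sigma> (Suc D)) rOut = int (ans D)"
    by blast
  then obtain t where t: "\<And>D. t D \<le> cost D" "\<And>D. halts_in B S query_prog (\<sigma> D) (t D) (\<sigma> (Suc D))"
    "\<And>D. fst (\<sigma> (Suc D)) rOut = int (ans D)"
    by metis
  have "oracle_run B S build_prog query_prog (input n p q) T t ans"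
    unfolding oracle_run_def using T(2) \<sigma>(1) t(2,3) by blast
  moreover have "ans D < n" for D
    using sel slot_less[OF n_pos] unfolding ans_def selection_def by blast
  moreover have "makespan n h (\<lambda>D. Some (ans D)) \<le> 2"
    unfolding ans_def by (rule makespan_selection[OF sel])
  moreover have "(\<Sum>D<m. t D) \<le> (9 * l + 15) * m" for m
  proof -
    have "(\<Sum>D<m. t D) \<le> (\<Sum>D<m. cost D)" by (intro sum_mono t)
    also have "\<dots> = (9 * l + 11) * m + 4 * (\<Sum>D<m. carries (prev k n) D)"
      by (simp add: cost_def sum.distrib sum_distrib_left)
    \<comment> \<open>Amortization: at most \<open>m\<close> carries in \<open>m\<close> days, at
      four instructions each.\<close>
    also have "\<dots> \<le> (9 * l + 15) * m"
      using sum_carries[of "prev k n" m] by (simp add: algebra_simps)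
    finally show ?thesis .
  qed
  ultimately show ?thesis using T(1) by blast
qed

end

theorem theorem11:
  shows "\<exists>(build :: program) (query :: program) (c :: nat) (C :: nat). c > 0 \<and>
    (\<forall>w n h p q. bgt_instance n h \<and> encodes w n h p q \<longrightarrow>
      (\<exists>S T t ans.
         oracle_run (c * w) S build query (input n p q) T t ans \<and>
         (\<forall>D. ans D < n) \<and>
         makespan n h (\<lambda>D. Some (ans D)) \<le> 2 \<and>
         S \<le> C * n \<and>
         real T \<le> real C * (real n * log 2 (real n + 1)) \<and>
         (\<forall>m. real (\<Sum>D<m. t D) \<le> real C * (real m * log 2 (real n + 1)))))"
proof -
  have "\<exists>S T t ans.
         oracle_run (4 * w) S build_prog query_prog (input n p q) T t ans \<and>
         (\<forall>D. ans D < n) \<and>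
         makespan n h (\<lambda>D. Some (ans D)) \<le> 2 \<and>
         S \<le> 120 * n \<and>
         real T \<le> real 120 * (real n * log 2 (real n + 1)) \<and>
         (\<forall>m. real (\<Sum>D<m. t D) \<le> real 120 * (real m * log 2 (real n + 1)))"
    if "bgt_instance n h" "encodes w n h p q" for w n h p q
  proof -
    interpret bgt_input w n h p q using that by unfold_locales
    define L where "L = log 2 (real n + 1)"
    define l where "l = nat \<lceil>L\<rceil>"
    have L: "1 \<le> L" using n_pos by (simp add: L_def le_log_iff)
    \<comment> \<open>Rounding up adds at most 1, and \<open>1 \<le> L\<close> absorbs it into a
      factor 2.\<close>
    then have l: "real l \<le> 2 * L" "L \<le> real l" by (auto simp: l_def) linarith+
    have "real n + 1 = 2 powr L" by (simp add: L_def)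
    also have "\<dots> \<le> 2 powr real l" using l(2) by simp
    finally have "real n + 1 \<le> 2 ^ l" by (simp add: powr_realpow)
    then have "n < 2 ^ l"
      by (metis add.commute of_nat_Suc of_nat_le_iff of_nat_numeral of_nat_power Suc_le_eq)
    then obtain T t ans where o: "oracle_run B S build_prog query_prog (input n p q) T t ans"
      "\<forall>D. ans D < n" "makespan n h (\<lambda>D. Some (ans D)) \<le> 2" and T: "T \<le> (19 * l + 62) * n + 16"
      and t: "\<And>m. (\<Sum>D<m. t D) \<le> (9 * l + 15) * m"
      using oracle_exists by blast
    \<comment> \<open>The additive 16 is at most \<open>16 * n\<close>.\<close>
    have "real T \<le> real ((19 * l + 78) * n)"
      using T n_pos by (subst of_nat_le_iff) (simp add: algebra_simps)
    also have "\<dots> = (19 * real l + 78) * real n" by simp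
    \<comment> \<open>\<open>19 * l + 78\<close> is at most
      \<open>38 * L + 78 * L = 116 * L\<close>.\<close>
    also have "\<dots> \<le> (120 * L) * real n" using l L by (intro mult_right_mono) auto
    finally have "real T \<le> real 120 * (real n * L)" by (simp add: ac_simps)
    moreover have "real (\<Sum>D<m. t D) \<le> real 120 * (real m * L)" for m
    proof -
      have "real (\<Sum>D<m. t D) \<le> real ((9 * l + 15) * m)" using t[of m] by (simp only: of_nat_le_iff)
      also have "\<dots> = (9 * real l + 15) * real m" by simp
      also have "\<dots> \<le> (120 * L) * real m" using l L by (intro mult_right_mono) auto
      finally show ?thesis by (simp add: ac_simps)
    qed
    ultimately show ?thesis using o unfolding L_def
      by (intro exI[of _ S] exI[of _ T] exI[of _ t] exI[of _ ans]) auto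
  qed
  then show ?thesis by (intro exI[of _ build_prog] exI[of _ query_prog] exI[of _ 4] exI[of _ 120]) auto
qed

end
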